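(* Let $\mathbf V$ be a variety with RexDFC (right existentially definable factor congruences) that is stable by complements. If $A,B\in\mathbf V$ and $f:A\to B$ is a homomorphism, then $f|_{Z(A)}:Z(A)\to Z(B)$, $\vec e\mapsto f(\vec e)$, is a Boolean algebra homomorphism from $\mathbf Z(A)$ to $\mathbf Z(B)$.
   Context: All algebras are assumed to have a type consisting of finitely many function symbols, each of finite arity. A variety with $\vec 0$ and $\vec 1$ is a variety $\mathbf V$ for which there are $0$-ary terms $0_1,\dots,0_n,1_1,\dots,1_n$ such that $\mathbf V\models \vec 0\approx\vec 1\rightarrow x\approx y$, where $\vec 0=(0_1,\dots,0_n)$, $\vec 1=(1_1,\dots,1_n)$. For $\vec a\in A^n$, $\vec b\in B^n$, $[\vec a,\vec b]$ denotes $((a_1,b_1),\dots,(a_n,b_n))\in(A\times B)^n$; for $\vec a,\vec b\in A^n$ and a congruence $\theta$ of $A$, $[\vec a,\vec b]\in\theta$ means $(a_i,b_i)\in\theta$ for $i=1,\dots,n$. For a homomorphism $f:A\to B$ and $\vec e\in A^n$, $f(\vec e)=(f(e_1),\dots,f(e_n))$. Let $A\in\mathbf V$. A tuple $\vec e\in A^n$ is a central element of $A$ if there is an isomorphism $\tau:A\to A_1\times A_2$ with $\tau(\vec e)=[\vec 0,\vec 1]$; $Z(A)$ is the set of central elements. $\vec e$ and $\vec f$ are complementary central elements, written $\vec e\diamond_A\vec f$, if there is an isomorphism $\tau:A\to A_1\times A_2$ with $\tau(\vec e)=[\vec 0,\vec 1]$ and $\tau(\vec f)=[\vec 1,\vec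 0]$. Congruences $\theta,\delta$ of $A$ are complementary factor congruences if $\theta\cap\delta=\Delta$ (identity) and $\theta\circ\delta=\nabla$ (universal); each is then called a factor congruence. $\mathbf V$ has Boolean factor congruences (BFC) if for every $A\in\mathbf V$ the set of factor congruences of $A$ is a Boolean sublattice of the congruence lattice of $A$. When $\mathbf V$ has BFC, for each $\vec e\in Z(A)$ there is a unique pair of complementary factor congruences $(\theta_{\vec 0,\vec e},\theta_{\vec 1,\vec e})$ of $A$ with $[\vec e,\vec 0]\in\theta_{\vec 0,\vec e}$ and $[\vec e,\vec 1]\in\theta_{\vec 1,\vec e}$. When $\mathbf V$ has BFC, $\mathbf Z(A)=(Z(A),\wedge_A,\vee_A,{}^{c_A},\vec 0,\vec 1)$ is a Boolean algebra, where: $\vec e^{\,c_A}$ is the only $\vec z$ with $[\vec z,\vec 1]\in\theta_{\vec 0,\vec e}$ and $[\vec z,\vec 0]\in\theta_{\vec 1,\vec e}$; $\vec e\wedge_A\vec f$ is the only $\vec z$ with $[\vec z,\vec 0]\in\theta_{\vec 0,\vec e}\cap\theta_{\vec 0,\vec f}$ and $[\vec z,\vec 1]\in\theta_{\vec 1,\vec e}\vee\theta_{\vec 1,\vec f}$; $\vec e\vee_A\vec f$ is the only $\vec z$ with $[\vec z,\vec 0]\in\theta_{\vec 0,\vec e}\vee\theta_{\vec 0,\vec f}$ and $[\vec z,\vec 1]\in\theta_{\vec 1,\vec e}\cap\theta_{\vec 1,\vec f}$ (joins of congruences taken in the congruence lattice). $\mathbf V$ has RexDFC if it is a variety with $\vec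 0$ and $\vec 1$ having BFC and there is an existential first order formula $\lambda(\vec z,x,y)$ such that for every $A,B\in\mathbf V$, $a,b\in A$, $c,d\in B$: $A\times B\models\lambda([\vec 0,\vec 1],(a,c),(b,d))$ iff $c=d$. A homomorphism $f:A\to B$ between members of $\mathbf V$ preserves complementary central elements if $f(\vec e)\in Z(B)$ for all $\vec e\in Z(A)$ and $\vec e_1\diamond_A\vec e_2$ implies $f(\vec e_1)\diamond_B f(\vec e_2)$. $\mathbf V$ is stable by complements if every homomorphism of $\mathbf V$ preserves complementary central elements. *)

theory Defs
  imports Main
begin

section \<open>Terms and algebras\<close>

text \<open>
  A signature is a partial map from symbols to arities whose domain is the set of function
  symbols. Variables are natural numbers.
\<close>

type_synonym 'f signature = "'f \<Rightarrow> nat option"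

datatype ('f, vars: 'v) trm = Var 'v | Fun 'f "('f, 'v) trm list"

type_synonym 'f identity = "('f, nat) trm \<times> ('f, nat) trm"

primrec wf_trm :: "'f signature \<Rightarrow> ('f, 'v) trm \<Rightarrow> bool" where
  "wf_trm Sg (Var x) \<longleftrightarrow> True"
| "wf_trm Sg (Fun F ts) \<longleftrightarrow> Sg F = Some (length ts) \<and> list_all (wf_trm Sg) ts"

text \<open>Only the values of \<open>ops\<close> on lists over the carrier of the right length matter.\<close>

record ('f, 'a) algebra =
  carrier :: "'a set"
  ops :: "'f \<Rightarrow> 'a list \<Rightarrow> 'a"

definition is_algebra :: "'f signature \<Rightarrow> ('f, 'a) algebra \<Rightarrow> bool" where
  "is_algebra Sg A \<longleftrightarrow> carrier A \<noteq> {} \<and>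
     (\<forall>F as. Sg F = Some (length as) \<and> set as \<subseteq> carrier A \<longrightarrow> ops A F as \<in> carrier A)"

primrec eval :: "('f, 'a) algebra \<Rightarrow> ('v \<Rightarrow> 'a) \<Rightarrow> ('f, 'v) trm \<Rightarrow> 'a" where
  "eval A \<rho> (Var x) = \<rho> x"
| "eval A \<rho> (Fun F ts) = ops A F (map (eval A \<rho>) ts)"

definition prod_alg :: "('f, 'a) algebra \<Rightarrow> ('f, 'b) algebra \<Rightarrow> ('f, 'a \<times> 'b) algebra" where
  "prod_alg A B = \<lparr>carrier = carrier A \<times> carrier B,
     ops = (\<lambda>F ps. (ops A F (map fst ps), ops B F (map snd ps)))\<rparr>"

definition is_hom ::
  "'f signature \<Rightarrow> ('f, 'a) algebra \<Rightarrow> ('f, 'b) algebra \<Rightarrow> ('a \<Rightarrow> 'b) \<Rightarrow> bool" where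
  "is_hom Sg A B h \<longleftrightarrow> (\<forall>a\<in>carrier A. h a \<in> carrier B) \<and>
     (\<forall>F as. Sg F = Some (length as) \<and> set as \<subseteq> carrier A \<longrightarrow>
        h (ops A F as) = ops B F (map h as))"

definition is_iso ::
  "'f signature \<Rightarrow> ('f, 'a) algebra \<Rightarrow> ('f, 'b) algebra \<Rightarrow> ('a \<Rightarrow> 'b) \<Rightarrow> bool" where
  "is_iso Sg A B h \<longleftrightarrow> is_hom Sg A B h \<and> bij_betw h (carrier A) (carrier B)"

section \<open>First order formulas\<close>

datatype 'f fm =
    Eq "('f, nat) trm" "('f, nat) trm"
  | Neg "'f fm"
  | Conj "'f fm" "'f fm"
  | Disj "'f fm" "'f fm"
  | Ex nat "'f fm"
  | All nat "'f fm"

primrec wf_fm :: "'f signature \<Rightarrow> 'f fm \<Rightarrow> bool" where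
  "wf_fm Sg (Eq s t) \<longleftrightarrow> wf_trm Sg s \<and> wf_trm Sg t"
| "wf_fm Sg (Neg p) \<longleftrightarrow> wf_fm Sg p"
| "wf_fm Sg (Conj p q) \<longleftrightarrow> wf_fm Sg p \<and> wf_fm Sg q"
| "wf_fm Sg (Disj p q) \<longleftrightarrow> wf_fm Sg p \<and> wf_fm Sg q"
| "wf_fm Sg (Ex x p) \<longleftrightarrow> wf_fm Sg p"
| "wf_fm Sg (All x p) \<longleftrightarrow> wf_fm Sg p"

primrec fv :: "'f fm \<Rightarrow> nat set" where
  "fv (Eq s t) = vars s \<union> vars t"
| "fv (Neg p) = fv p"
| "fv (Conj p q) = fv p \<union> fv q"
| "fv (Disj p q) = fv p \<union> fv q"
| "fv (Ex x p) = fv p - {x}"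
| "fv (All x p) = fv p - {x}"

primrec sat :: "('f, 'a) algebra \<Rightarrow> (nat \<Rightarrow> 'a) \<Rightarrow> 'f fm \<Rightarrow> bool" where
  "sat A \<rho> (Eq s t) \<longleftrightarrow> eval A \<rho> s = eval A \<rho> t"
| "sat A \<rho> (Neg p) \<longleftrightarrow> \<not> sat A \<rho> p"
| "sat A \<rho> (Conj p q) \<longleftrightarrow> sat A \<rho> p \<and> sat A \<rho> q"
| "sat A \<rho> (Disj p q) \<longleftrightarrow> sat A \<rho> p \<or> sat A \<rho> q"
| "sat A \<rho> (Ex x p) \<longleftrightarrow> (\<exists>a\<in>carrier A. sat A (\<rho>(x := a)) p)"
| "sat A \<rho> (All x p) \<longleftrightarrow> (\<forall>a\<in>carrier A. sat A (\<rho>(x := a)) p)"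

primrec quantifier_free :: "'f fm \<Rightarrow> bool" where
  "quantifier_free (Eq s t) \<longleftrightarrow> True"
| "quantifier_free (Neg p) \<longleftrightarrow> quantifier_free p"
| "quantifier_free (Conj p q) \<longleftrightarrow> quantifier_free p \<and> quantifier_free q"
| "quantifier_free (Disj p q) \<longleftrightarrow> quantifier_free p \<and> quantifier_free q"
| "quantifier_free (Ex x p) \<longleftrightarrow> False"
| "quantifier_free (All x p) \<longleftrightarrow> False"

inductive existential :: "'f fm \<Rightarrow> bool" where
  "quantifier_free p \<Longrightarrow> existential p"
| "existential p \<Longrightarrow> existential (Ex x p)"

text \<open>
  Satisfaction of a formula whose free variables are among \<open>0, \<dots>, length vs - 1\<close>;
  the values of the assignment beyond that are irrelevant.
\<close>

definition holds :: "('f, 'a) algebra \<Rightarrow> 'f fm \<Rightarrow> 'a list \<Rightarrow> bool" where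
  "holds A p vs \<longleftrightarrow> sat A (\<lambda>i. vs ! i) p"

section \<open>Boolean algebras on a carrier set\<close>

record 'b bool_struct =
  elems :: "'b set"
  meet :: "'b \<Rightarrow> 'b \<Rightarrow> 'b"
  join :: "'b \<Rightarrow> 'b \<Rightarrow> 'b"
  compl :: "'b \<Rightarrow> 'b"
  bottom :: "'b"
  top_elem :: "'b"

definition is_boolean_algebra :: "'b bool_struct \<Rightarrow> bool" where
  "is_boolean_algebra L \<longleftrightarrow>
     bottom L \<in> elems L \<and> top_elem L \<in> elems L \<and>
     (\<forall>x\<in>elems L. compl L x \<in> elems L) \<and>
     (\<forall>x\<in>elems L. \<forall>y\<in>elems L. meet L x y \<in> elems L \<and> join L x y \<in> elems L) \<and>
     (\<forall>x\<in>elems L. \<forall>y\<in>elems L.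
        meet L x y = meet L y x \<and> join L x y = join L y x \<and>
        meet L x (join L x y) = x \<and> join L x (meet L x y) = x) \<and>
     (\<forall>x\<in>elems L. \<forall>y\<in>elems L. \<forall>z\<in>elems L.
        meet L (meet L x y) z = meet L x (meet L y z) \<and>
        join L (join L x y) z = join L x (join L y z) \<and>
        meet L x (join L y z) = join L (meet L x y) (meet L x z) \<and>
        join L x (meet L y z) = meet L (join L x y) (join L x z)) \<and>
     (\<forall>x\<in>elems L.
        meet L x (top_elem L) = x \<and> join L x (bottom L) = x \<and>
        meet L x (compl L x) = bottom L \<and> join L x (compl L x) = top_elem L)"

definition is_boolean_hom :: "'b bool_struct \<Rightarrow> 'c bool_struct \<Rightarrow> ('b \<Rightarrow> 'c) \<Rightarrow> bool" where
  "is_boolean_hom L M h \<longleftrightarrow>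
     is_boolean_algebra L \<and> is_boolean_algebra M \<and>
     (\<forall>x\<in>elems L. h x \<in> elems M) \<and>
     (\<forall>x\<in>elems L. \<forall>y\<in>elems L.
        h (meet L x y) = meet M (h x) (h y) \<and> h (join L x y) = join M (h x) (h y)) \<and>
     (\<forall>x\<in>elems L. h (compl L x) = compl M (h x)) \<and>
     h (bottom L) = bottom M \<and> h (top_elem L) = top_elem M"

section \<open>Congruences\<close>

definition congruence :: "'f signature \<Rightarrow> ('f, 'a) algebra \<Rightarrow> ('a \<times> 'a) set \<Rightarrow> bool" where
  "congruence Sg A \<theta> \<longleftrightarrow> equiv (carrier A) \<theta> \<and>
     (\<forall>F as bs. Sg F = Some (length as) \<and> list_all2 (\<lambda>a b. (a, b) \<in> \<theta>) as bs \<longrightarrow>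
        (ops A F as, ops A F bs) \<in> \<theta>)"

text \<open>Joins in the congruence lattice; meets are intersections.\<close>

definition cong_join ::
  "'f signature \<Rightarrow> ('f, 'a) algebra \<Rightarrow> ('a \<times> 'a) set \<Rightarrow> ('a \<times> 'a) set \<Rightarrow> ('a \<times> 'a) set" where
  "cong_join Sg A \<theta> \<delta> = \<Inter>{\<gamma>. congruence Sg A \<gamma> \<and> \<theta> \<subseteq> \<gamma> \<and> \<delta> \<subseteq> \<gamma>}"

definition compl_factor_congs ::
  "'f signature \<Rightarrow> ('f, 'a) algebra \<Rightarrow> ('a \<times> 'a) set \<Rightarrow> ('a \<times> 'a) set \<Rightarrow> bool" where
  "compl_factor_congs Sg A \<theta> \<delta> \<longleftrightarrow> congruence Sg A \<theta> \<and> congruence Sg A \<delta> \<and>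
     \<theta> \<inter> \<delta> = Id_on (carrier A) \<and> \<theta> O \<delta> = carrier A \<times> carrier A"

definition factor_congs :: "'f signature \<Rightarrow> ('f, 'a) algebra \<Rightarrow> ('a \<times> 'a) set set" where
  "factor_congs Sg A = {\<theta>. \<exists>\<delta>. compl_factor_congs Sg A \<theta> \<delta>}"

section \<open>Varieties\<close>

text \<open>
  A variety is given by its signature and a set of identities. Membership makes sense for
  algebras over every carrier type. Properties of a variety that quantify over its members take
  a type \<open>'u\<close> as argument and quantify over the members whose carrier is a subset of \<open>'u\<close>.
  The universe \<open>'u\<close> is meant to be an arbitrary infinite type, so that up to isomorphism
  the members over it are closed under binary products and include the countable free algebras.
\<close>

definition is_variety :: "'f signature \<Rightarrow> 'f identity set \<Rightarrow> bool" where
  "is_variety Sg E \<longleftrightarrow> finite (dom Sg) \<and> (\<forall>(s, t)\<in>E. wf_trm Sg s \<and> wf_trm Sg t)"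

definition members :: "'f signature \<Rightarrow> 'f identity set \<Rightarrow> ('f, 'a) algebra set" where
  "members Sg E = {A. is_algebra Sg A \<and>
     (\<forall>(s, t)\<in>E. \<forall>\<rho>. range \<rho> \<subseteq> carrier A \<longrightarrow> eval A \<rho> s = eval A \<rho> t)}"

text \<open>The tuple of values of a list of closed terms; the assignment is irrelevant.\<close>

definition const_tuple :: "('f, 'a) algebra \<Rightarrow> ('f, nat) trm list \<Rightarrow> 'a list" where
  "const_tuple A ts = map (eval A (\<lambda>_. undefined)) ts"

definition variety_with_01 ::
  "'u itself \<Rightarrow> 'f signature \<Rightarrow> 'f identity set \<Rightarrow> ('f, nat) trm list \<Rightarrow> ('f, nat) trm list \<Rightarrow> bool"
where
  "variety_with_01 U Sg E Zs Os \<longleftrightarrow> is_variety Sg E \<and> length Zs = length Os \<and>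
     (\<forall>t\<in>set Zs \<union> set Os. wf_trm Sg t \<and> vars t = {}) \<and>
     (\<forall>A\<in>(members Sg E :: ('f, 'u) algebra set). const_tuple A Zs = const_tuple A Os \<longrightarrow>
        (\<forall>x\<in>carrier A. \<forall>y\<in>carrier A. x = y))"

definition has_BFC :: "'u itself \<Rightarrow> 'f signature \<Rightarrow> 'f identity set \<Rightarrow> bool" where
  "has_BFC U Sg E \<longleftrightarrow> (\<forall>A\<in>(members Sg E :: ('f, 'u) algebra set).
     \<exists>c. is_boolean_algebra \<lparr>elems = factor_congs Sg A, meet = (\<inter>), join = cong_join Sg A,
       compl = c, bottom = Id_on (carrier A), top_elem = carrier A \<times> carrier A\<rparr>)"

text \<open>
  The variables \<open>0, \<dots>, n - 1\<close> of the formula stand for the tuple \<open>z\<close>, the variables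
  \<open>n\<close> and \<open>n + 1\<close> for \<open>x\<close> and \<open>y\<close>, where \<open>n = length Zs\<close>.
\<close>

definition has_RexDFC ::
  "'u itself \<Rightarrow> 'f signature \<Rightarrow> 'f identity set \<Rightarrow> ('f, nat) trm list \<Rightarrow> ('f, nat) trm list \<Rightarrow> bool"
where
  "has_RexDFC U Sg E Zs Os \<longleftrightarrow> variety_with_01 U Sg E Zs Os \<and> has_BFC U Sg E \<and>
     (\<exists>l. wf_fm Sg l \<and> existential l \<and> fv l \<subseteq> {..<length Zs + 2} \<and>
        (\<forall>A\<in>(members Sg E :: ('f, 'u) algebra set). \<forall>B\<in>(members Sg E :: ('f, 'u) algebra set).
          \<forall>a\<in>carrier A. \<forall>b\<in>carrier A. \<forall>c\<in>carrier B. \<forall>d\<in>carrier B.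
            holds (prod_alg A B) l (zip (const_tuple A Zs) (const_tuple B Os) @ [(a, c), (b, d)])
              \<longleftrightarrow> c = d))"

section \<open>Central elements\<close>

text \<open>
  Taking both factors over the carrier type of \<open>A\<close> is no restriction: they are
  isomorphic to quotients of \<open>A\<close>, hence to algebras on sets of representatives.
\<close>

definition central_elems ::
  "'f signature \<Rightarrow> ('f, nat) trm list \<Rightarrow> ('f, nat) trm list \<Rightarrow> ('f, 'a) algebra \<Rightarrow> 'a list set" where
  "central_elems Sg Zs Os A = {e. set e \<subseteq> carrier A \<and>
     (\<exists>(A1 :: ('f, 'a) algebra) (A2 :: ('f, 'a) algebra) \<tau>.
        is_algebra Sg A1 \<and> is_algebra Sg A2 \<and> is_iso Sg A (prod_alg A1 A2) \<tau> \<and>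
        map \<tau> e = zip (const_tuple A1 Zs) (const_tuple A2 Os))}"

definition compl_central ::
  "'f signature \<Rightarrow> ('f, nat) trm list \<Rightarrow> ('f, nat) trm list \<Rightarrow> ('f, 'a) algebra \<Rightarrow>
     'a list \<Rightarrow> 'a list \<Rightarrow> bool" where
  "compl_central Sg Zs Os A e f \<longleftrightarrow> set e \<subseteq> carrier A \<and> set f \<subseteq> carrier A \<and>
     (\<exists>(A1 :: ('f, 'a) algebra) (A2 :: ('f, 'a) algebra) \<tau>.
        is_algebra Sg A1 \<and> is_algebra Sg A2 \<and> is_iso Sg A (prod_alg A1 A2) \<tau> \<and>
        map \<tau> e = zip (const_tuple A1 Zs) (const_tuple A2 Os) \<and>
        map \<tau> f = zip (const_tuple A1 Os) (const_tuple A2 Zs))"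

definition tuple_rel :: "('a \<times> 'a) set \<Rightarrow> 'a list \<Rightarrow> 'a list \<Rightarrow> bool" where
  "tuple_rel \<theta> as bs \<longleftrightarrow> list_all2 (\<lambda>a b. (a, b) \<in> \<theta>) as bs"

definition theta_pair ::
  "'f signature \<Rightarrow> ('f, nat) trm list \<Rightarrow> ('f, nat) trm list \<Rightarrow> ('f, 'a) algebra \<Rightarrow> 'a list \<Rightarrow>
     ('a \<times> 'a) set \<times> ('a \<times> 'a) set" where
  "theta_pair Sg Zs Os A e = (THE p. compl_factor_congs Sg A (fst p) (snd p) \<and>
     tuple_rel (fst p) e (const_tuple A Zs) \<and> tuple_rel (snd p) e (const_tuple A Os))"

definition theta0 ::
  "'f signature \<Rightarrow> ('f, nat) trm list \<Rightarrow> ('f, nat) trm list \<Rightarrow> ('f, 'a) algebra \<Rightarrow> 'a list \<Rightarrow>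
     ('a \<times> 'a) set" where
  "theta0 Sg Zs Os A e = fst (theta_pair Sg Zs Os A e)"

definition theta1 ::
  "'f signature \<Rightarrow> ('f, nat) trm list \<Rightarrow> ('f, nat) trm list \<Rightarrow> ('f, 'a) algebra \<Rightarrow> 'a list \<Rightarrow>
     ('a \<times> 'a) set" where
  "theta1 Sg Zs Os A e = snd (theta_pair Sg Zs Os A e)"

definition central_algebra ::
  "'f signature \<Rightarrow> ('f, nat) trm list \<Rightarrow> ('f, nat) trm list \<Rightarrow> ('f, 'a) algebra \<Rightarrow>
     'a list bool_struct" where
  "central_algebra Sg Zs Os A = \<lparr>
     elems = central_elems Sg Zs Os A,
     meet = (\<lambda>e f. THE z.
       tuple_rel (theta0 Sg Zs Os A e \<inter> theta0 Sg Zs Os A f) z (const_tuple A Zs) \<and>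
       tuple_rel (cong_join Sg A (theta1 Sg Zs Os A e) (theta1 Sg Zs Os A f)) z (const_tuple A Os)),
     join = (\<lambda>e f. THE z.
       tuple_rel (cong_join Sg A (theta0 Sg Zs Os A e) (theta0 Sg Zs Os A f)) z (const_tuple A Zs) \<and>
       tuple_rel (theta1 Sg Zs Os A e \<inter> theta1 Sg Zs Os A f) z (const_tuple A Os)),
     compl = (\<lambda>e. THE z.
       tuple_rel (theta0 Sg Zs Os A e) z (const_tuple A Os) \<and>
       tuple_rel (theta1 Sg Zs Os A e) z (const_tuple A Zs)),
     bottom = const_tuple A Zs,
     top_elem = const_tuple A Os\<rparr>"

definition preserves_compl_central ::
  "'f signature \<Rightarrow> ('f, nat) trm list \<Rightarrow> ('f, nat) trm list \<Rightarrow>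
     ('f, 'a) algebra \<Rightarrow> ('f, 'b) algebra \<Rightarrow> ('a \<Rightarrow> 'b) \<Rightarrow> bool" where
  "preserves_compl_central Sg Zs Os A B h \<longleftrightarrow>
     (\<forall>e\<in>central_elems Sg Zs Os A. map h e \<in> central_elems Sg Zs Os B) \<and>
     (\<forall>e1 e2. compl_central Sg Zs Os A e1 e2 \<longrightarrow>
        compl_central Sg Zs Os B (map h e1) (map h e2))"

definition stable_by_complements ::
  "'u itself \<Rightarrow> 'f signature \<Rightarrow> 'f identity set \<Rightarrow> ('f, nat) trm list \<Rightarrow> ('f, nat) trm list \<Rightarrow> bool"
where
  "stable_by_complements U Sg E Zs Os \<longleftrightarrow>
     (\<forall>A\<in>(members Sg E :: ('f, 'u) algebra set). \<forall>B\<in>(members Sg E :: ('f, 'u) algebra set).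
        \<forall>h. is_hom Sg A B h \<longrightarrow> preserves_compl_central Sg Zs Os A B h)"

end

theory Submission
  imports Defs
begin

text \<open>
  Since a quotient in which \<open>0 = 1\<close> is trivial, BFC makes the map sending a central element \<open>e\<close>
  to \<open>\<theta>\<^sub>0 e\<close> a bijection onto the factor congruences, and it carries the operations of \<open>Z(A)\<close> to
  those of the congruence lattice. Hence a homomorphism \<open>h\<close> respects the operations
  as soon as it maps \<open>\<theta>\<^sub>0 e\<close> into \<open>\<theta>\<^sub>0 (h e)\<close> and \<open>\<theta>\<^sub>1 e\<close> into \<open>\<theta>\<^sub>1 (h e)\<close>. Homomorphisms need not
  preserve existential formulas, but embeddings do, and \<open>x \<mapsto> (x, h x)\<close> is an embedding of \<open>A\<close>
  into \<open>A \<times> B\<close> that maps \<open>e\<close> to the central element \<open>(e, h e)\<close>. So the formula defining \<open>\<theta>\<^sub>1\<close>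
  gives the claim for \<open>\<theta>\<^sub>1\<close>, and preservation of complements exchanges \<open>\<theta>\<^sub>0\<close> and \<open>\<theta>\<^sub>1\<close>.
\<close>

section \<open>Homomorphisms and terms\<close>

lemma eval_in_carrier:
  assumes "is_algebra Sg A" and "wf_trm Sg t" and "\<And>v. v \<in> vars t \<Longrightarrow> \<rho> v \<in> carrier A"
  shows "eval A \<rho> t \<in> carrier A"
  using assms(2,3)
proof (induction t)
  case (Fun F ts)
  then have "set (map (eval A \<rho>) ts) \<subseteq> carrier A"
    by (fastforce simp: list_all_iff)
  then show ?case
    using assms(1) Fun.prems(1) by (simp add: is_algebra_def)
qed simp

lemma eval_hom:
  assumes "is_algebra Sg A" and "is_hom Sg A B h"
    and "wf_trm Sg t" and "\<And>v. v \<in> vars t \<Longrightarrow> \<rho> v \<in> carrier A"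
  shows "h (eval A \<rho> t) = eval B (h \<circ> \<rho>) t"
  using assms(3,4)
proof (induction t)
  case (Fun F ts)
  then have "set (map (eval A \<rho>) ts) \<subseteq> carrier A"
    using eval_in_carrier[OF assms(1)] by (fastforce simp: list_all_iff)
  then have "h (eval A \<rho> (Fun F ts)) = ops B F (map h (map (eval A \<rho>) ts))"
    using assms(2) Fun.prems(1) unfolding is_hom_def
    by (metis eval.simps(2) length_map wf_trm.simps(2))
  also have "map h (map (eval A \<rho>) ts) = map (eval B (h \<circ> \<rho>)) ts"
    using Fun by (fastforce simp: list_all_iff)
  finally show ?case by (simp only: eval.simps)
qed simp

lemma eval_cong_vars:
  assumes "\<And>v. v \<in> vars t \<Longrightarrow> \<rho> v = \<rho>' v"
  shows "eval A \<rho> t = eval A \<rho>' t"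
  using assms
proof (induction t)
  case (Fun F ts)
  then have "map (eval A \<rho>) ts = map (eval A \<rho>') ts"
    by fastforce
  then show ?case by (metis eval.simps(2))
qed simp

lemma length_const_tuple [simp]: "length (const_tuple A ts) = length ts"
  by (simp add: const_tuple_def)

lemma set_const_tuple:
  assumes "is_algebra Sg A" and "\<forall>t\<in>set ts. wf_trm Sg t \<and> vars t = {}"
  shows "set (const_tuple A ts) \<subseteq> carrier A"
  using assms eval_in_carrier by (fastforce simp: const_tuple_def)

lemma map_const_tuple:
  assumes "is_algebra Sg A" and "is_hom Sg A B h"
    and "\<forall>t\<in>set ts. wf_trm Sg t \<and> vars t = {}"
  shows "map h (const_tuple A ts) = const_tuple B ts"
proof -
  have "h (eval A (\<lambda>_. undefined) t) = eval B (\<lambda>_. undefined) t" if "t \<in> set ts" for t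
    using eval_hom[OF assms(1,2), of t "\<lambda>_. undefined"] assms(3) that
      eval_cong_vars[of t "h \<circ> (\<lambda>_. undefined)" "\<lambda>_. undefined" B]
    by auto
  then show ?thesis by (simp add: const_tuple_def)
qed

lemma is_hom_comp:
  assumes "is_hom Sg A B g" and "is_hom Sg B C h"
  shows "is_hom Sg A C (h \<circ> g)"
  unfolding is_hom_def
proof (intro conjI allI impI ballI)
  show "(h \<circ> g) a \<in> carrier C" if "a \<in> carrier A" for a
    using assms that by (simp add: is_hom_def)
  fix F as assume *: "Sg F = Some (length as) \<and> set as \<subseteq> carrier A"
  then have "set (map g as) \<subseteq> carrier B"
    using assms(1) by (auto simp: is_hom_def)
  then have "h (ops B F (map g as)) = ops C F (map h (map g as))"
    using assms(2) * unfolding is_hom_def by (metis length_map)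
  then show "(h \<circ> g) (ops A F as) = ops C F (map (h \<circ> g) as)"
    using assms(1) * by (simp add: is_hom_def)
qed

section \<open>Products and inverses of isomorphisms\<close>

lemma is_hom_fst: "is_hom Sg (prod_alg A B) A fst"
  and is_hom_snd: "is_hom Sg (prod_alg A B) B snd"
  by (auto simp: is_hom_def prod_alg_def)

lemma is_hom_pair:
  assumes "is_hom Sg A B f" and "is_hom Sg A C g"
  shows "is_hom Sg A (prod_alg B C) (\<lambda>x. (f x, g x))"
  using assms by (auto simp: is_hom_def prod_alg_def comp_def)

lemma is_algebra_prod:
  assumes "is_algebra Sg A" and "is_algebra Sg B"
  shows "is_algebra Sg (prod_alg A B)"
proof -
  have "ops A F (map fst ps) \<in> carrier A \<and> ops B F (map snd ps) \<in> carrier B"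
    if "Sg F = Some (length ps)" "set ps \<subseteq> carrier A \<times> carrier B" for F ps
  proof -
    have "set (map fst ps) \<subseteq> carrier A" "set (map snd ps) \<subseteq> carrier B"
      using that(2) by auto
    then show ?thesis
      using assms that(1) unfolding is_algebra_def by (metis length_map)
  qed
  then show ?thesis
    using assms by (simp add: is_algebra_def prod_alg_def)
qed

lemma is_hom_inv_into:
  assumes "is_algebra Sg A" and "is_iso Sg A B h"
  shows "is_hom Sg B A (inv_into (carrier A) h)" (is "is_hom _ _ _ ?g")
proof -
  have inj: "inj_on h (carrier A)" and im: "h ` carrier A = carrier B" and hom: "is_hom Sg A B h"
    using assms(2) by (auto simp: is_iso_def bij_betw_def)
  have mem: "?g b \<in> carrier A" and hg: "h (?g b) = b" if "b \<in> carrier B" for b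
    using that im by (auto simp: inv_into_into f_inv_into_f)
  show ?thesis
    unfolding is_hom_def
  proof (intro conjI allI impI ballI)
    fix F bs assume *: "Sg F = Some (length bs) \<and> set bs \<subseteq> carrier B"
    then have sub: "set (map ?g bs) \<subseteq> carrier A"
      using mem by auto
    have "map h (map ?g bs) = bs"
      using * hg by (auto intro!: map_idI simp: subset_iff)
    then have "ops B F bs = h (ops A F (map ?g bs))"
      using hom sub * unfolding is_hom_def by (metis length_map)
    moreover have "ops A F (map ?g bs) \<in> carrier A"
      using assms(1) sub * unfolding is_algebra_def by (metis length_map)
    ultimately show "?g (ops B F bs) = ops A F (map ?g bs)"
      using inj by simp
  qed (use mem in auto)
qed

section \<open>Members of a variety\<close>

lemma is_algebra_hom_image:
  assumes "is_algebra Sg A" and "is_hom Sg A B h" and "h ` carrier A = carrier B"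
  shows "is_algebra Sg B"
  unfolding is_algebra_def
proof (intro conjI allI impI)
  show "carrier B \<noteq> {}"
    using assms by (auto simp: is_algebra_def)
  fix F bs assume *: "Sg F = Some (length bs) \<and> set bs \<subseteq> carrier B"
  then have "bs \<in> lists (h ` carrier A)"
    using assms(3) by auto
  then obtain as where as: "bs = map h as" "set as \<subseteq> carrier A"
    by (auto simp: lists_image)
  then have "ops B F bs = h (ops A F as)" "ops A F as \<in> carrier A"
    using assms * by (auto simp: is_hom_def is_algebra_def)
  then show "ops B F bs \<in> carrier B"
    using assms(3) by auto
qed

text \<open>An assignment into \<open>B\<close> lifts through the surjection \<open>h\<close> to one
  into \<open>A\<close>, where the identity is known, and \<open>eval_hom\<close> carries the
  equality back. Quotients and direct factors of members are seen to be members in this way.\<close>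

lemma members_hom_image:
  assumes "is_variety Sg E" and "A \<in> members Sg E"
    and "is_hom Sg A B h" and "h ` carrier A = carrier B"
  shows "B \<in> members Sg E"
proof -
  have alg: "is_algebra Sg A"
    using assms(2) by (simp add: members_def)
  have "eval B \<rho> s = eval B \<rho> t" if "(s, t) \<in> E" "range \<rho> \<subseteq> carrier B" for s t \<rho>
  proof -
    define \<sigma> where "\<sigma> = inv_into (carrier A) h \<circ> \<rho>"
    have \<sigma>: "\<sigma> v \<in> carrier A" "h (\<sigma> v) = \<rho> v" for v
      using that(2) assms(4) by (auto simp: \<sigma>_def inv_into_into f_inv_into_f image_subset_iff)
    have wf: "wf_trm Sg s" "wf_trm Sg t"
      using assms(1) that(1) by (auto simp: is_variety_def)
    have "range \<sigma> \<subseteq> carrier A"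
      using \<sigma>(1) by auto
    then have "eval A \<sigma> s = eval A \<sigma> t"
      using assms(2) that(1) by (auto simp: members_def)
    moreover have "h \<circ> \<sigma> = \<rho>"
      using \<sigma>(2) by auto
    ultimately show ?thesis
      using eval_hom[OF alg assms(3)] wf \<sigma>(1) by metis
  qed
  then show ?thesis
    using is_algebra_hom_image[OF alg assms(3,4)] by (auto simp: members_def)
qed

lemma members_prod:
  assumes "is_variety Sg E" and "A \<in> members Sg E" and "B \<in> members Sg E"
  shows "prod_alg A B \<in> members Sg E"
proof -
  have alg: "is_algebra Sg (prod_alg A B)"
    using assms by (auto simp: members_def intro: is_algebra_prod)
  have "eval (prod_alg A B) \<rho> s = eval (prod_alg A B) \<rho> t"
    if st: "(s, t) \<in> E" and \<rho>: "range \<rho> \<subseteq> carrier (prod_alg A B)" for s t \<rho>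
  proof (rule prod_eqI)
    have wf: "wf_trm Sg s" "wf_trm Sg t"
      using assms(1) st by (auto simp: is_variety_def)
    have \<rho>': "\<rho> v \<in> carrier (prod_alg A B)" for v
      using \<rho> by auto
    then have "range (fst \<circ> \<rho>) \<subseteq> carrier A" "range (snd \<circ> \<rho>) \<subseteq> carrier B"
      by (auto simp: prod_alg_def mem_Times_iff)
    then have "eval A (fst \<circ> \<rho>) s = eval A (fst \<circ> \<rho>) t" "eval B (snd \<circ> \<rho>) s = eval B (snd \<circ> \<rho>) t"
      using assms(2,3) st by (auto simp: members_def)
    then show "fst (eval (prod_alg A B) \<rho> s) = fst (eval (prod_alg A B) \<rho> t)"
      "snd (eval (prod_alg A B) \<rho> s) = snd (eval (prod_alg A B) \<rho> t)"
      using eval_hom[OF alg is_hom_fst] eval_hom[OF alg is_hom_snd] wf \<rho>' by metis+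
  qed
  then show ?thesis
    using alg by (auto simp: members_def)
qed

text \<open>Serves to copy a product of members, whose elements are pairs, back into the universe
  \<open>'u\<close>. Since \<open>g\<close> is injective on the whole type, \<open>inv g\<close>
  recovers the arguments.\<close>

lemma obtain_transported_algebra:
  fixes A :: "('f, 'a) algebra" and g :: "'a \<Rightarrow> 'b"
  assumes "is_algebra Sg A" and "inj g"
  obtains B where "is_hom Sg A B g" and "g ` carrier A = carrier B"
proof
  let ?B = "\<lparr>carrier = g ` carrier A, ops = (\<lambda>F bs. g (ops A F (map (inv g) bs)))\<rparr>"
  show "is_hom Sg A ?B g"
    using assms(2) by (auto simp: is_hom_def)
qed simp

section \<open>Embeddings preserve existential formulas\<close>

text \<open>Homomorphisms preserve equations and injective ones also reflect them. Negation swaps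
  the two directions, so the induction has to carry the equivalence.\<close>

lemma sat_quantifier_free_embedding:
  assumes "is_algebra Sg A" and "is_hom Sg A B h" and "inj_on h (carrier A)"
    and "quantifier_free p" and "wf_fm Sg p" and "\<And>v. v \<in> fv p \<Longrightarrow> \<rho> v \<in> carrier A"
  shows "sat A \<rho> p \<longleftrightarrow> sat B (h \<circ> \<rho>) p"
  using assms(4-6)
proof (induction p)
  case (Eq s t)
  then have "eval A \<rho> s \<in> carrier A" "eval A \<rho> t \<in> carrier A"
    "h (eval A \<rho> s) = eval B (h \<circ> \<rho>) s" "h (eval A \<rho> t) = eval B (h \<circ> \<rho>) t"
    using eval_in_carrier[OF assms(1), of s \<rho>] eval_in_carrier[OF assms(1), of t \<rho>]
      eval_hom[OF assms(1,2), of s \<rho>] eval_hom[OF assms(1,2), of t \<rho>] by auto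
  then show ?case
    using assms(3) by (metis inj_on_eq_iff sat.simps(1))
qed auto

lemma sat_cong_fv:
  assumes "\<And>v. v \<in> fv p \<Longrightarrow> \<rho> v = \<rho>' v"
  shows "sat A \<rho> p \<longleftrightarrow> sat A \<rho>' p"
  using assms
proof (induction p arbitrary: \<rho> \<rho>')
  case (Eq s t)
  then show ?case
    using eval_cong_vars[of s \<rho> \<rho>' A] eval_cong_vars[of t \<rho> \<rho>' A] by simp
next
  case (Ex x p)
  then have "sat A (\<rho>(x := a)) p \<longleftrightarrow> sat A (\<rho>'(x := a)) p" for a
    by (intro Ex.IH) auto
  then show ?case by simp
next
  case (All x p)
  then have "sat A (\<rho>(x := a)) p \<longleftrightarrow> sat A (\<rho>'(x := a)) p" for a
    by (intro All.IH) auto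
  then show ?case by simp
next
  case (Neg p)
  then show ?case by (metis fv.simps(2) sat.simps(2))
next
  case (Conj p q)
  then show ?case by (metis UnCI fv.simps(3) sat.simps(3))
next
  case (Disj p q)
  then show ?case by (metis UnCI fv.simps(4) sat.simps(4))
qed

text \<open>A witness \<open>a\<close> in \<open>A\<close> is sent to the witness \<open>h a\<close>
  in \<open>B\<close>. Only this direction survives a quantifier, since a witness in
  \<open>B\<close> may lie outside the image of \<open>h\<close>.\<close>

lemma sat_existential_embedding:
  assumes "is_algebra Sg A" and "is_hom Sg A B h" and "inj_on h (carrier A)"
    and "existential p" and "wf_fm Sg p" and "\<And>v. v \<in> fv p \<Longrightarrow> \<rho> v \<in> carrier A"
    and "sat A \<rho> p"
  shows "sat B (h \<circ> \<rho>) p"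
  using assms(4-7)
proof (induction p arbitrary: \<rho>)
  case (1 p)
  then show ?case
    using sat_quantifier_free_embedding[OF assms(1-3)] by blast
next
  case (2 p x)
  then obtain a where a: "a \<in> carrier A" "sat A (\<rho>(x := a)) p"
    by auto
  have "sat B (h \<circ> \<rho>(x := a)) p"
  proof (rule "2.IH")
    show "(\<rho>(x := a)) v \<in> carrier A" if "v \<in> fv p" for v
      using that a(1) "2.prems"(2) by simp
    show "sat A (\<rho>(x := a)) p"
      by (rule a(2))
  qed (use "2.prems"(1) in simp)
  moreover have "h \<circ> \<rho>(x := a) = (h \<circ> \<rho>)(x := h a)"
    by auto
  ultimately show ?case
    using a(1) assms(2) unfolding is_hom_def sat.simps by metis
qed

lemma holds_existential_embedding:
  assumes "is_algebra Sg A" and "is_hom Sg A B h" and "inj_on h (carrier A)"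
    and "existential p" and "wf_fm Sg p" and "fv p \<subseteq> {..<length vs}" and "set vs \<subseteq> carrier A"
    and "holds A p vs"
  shows "holds B p (map h vs)"
proof -
  have "sat B (h \<circ> (\<lambda>i. vs ! i)) p"
  proof (rule sat_existential_embedding[OF assms(1-5)])
    show "vs ! v \<in> carrier A" if "v \<in> fv p" for v
      using that assms(6,7) nth_mem by blast
  qed (use assms(8) in \<open>simp add: holds_def\<close>)
  \<comment> \<open>On the free variables, all below \<open>length vs\<close>, \<open>nth\<close>
    commutes with \<open>map\<close>; elsewhere the two assignments may differ.\<close>
  moreover have "(h \<circ> (\<lambda>i. vs ! i)) v = map h vs ! v" if "v \<in> fv p" for v
    using that assms(6) by auto
  ultimately show ?thesis
    using sat_cong_fv[of p "h \<circ> (\<lambda>i. vs ! i)" "\<lambda>i. map h vs ! i" B] by (simp add: holds_def)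
qed

section \<open>Boolean algebras\<close>

lemma boolean_algebra_bounds:
  assumes "is_boolean_algebra L"
  shows "bottom L \<in> elems L" "top_elem L \<in> elems L"
    and "x \<in> elems L \<Longrightarrow> meet L x (top_elem L) = x" "x \<in> elems L \<Longrightarrow> join L x (bottom L) = x"
  using assms unfolding is_boolean_algebra_def by blast+

lemma boolean_algebra_compl:
  assumes "is_boolean_algebra L" and "x \<in> elems L"
  shows "compl L x \<in> elems L" "meet L x (compl L x) = bottom L" "join L x (compl L x) = top_elem L"
  using assms unfolding is_boolean_algebra_def by blast+

lemma boolean_algebra_lattice:
  assumes "is_boolean_algebra L" and "x \<in> elems L" and "y \<in> elems L"
  shows "meet L x y \<in> elems L" "join L x y \<in> elems L"
    and "meet L x y = meet L y x" "join L x y = join L y x"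
    and "meet L x (join L x y) = x" "join L x (meet L x y) = x"
  using assms unfolding is_boolean_algebra_def by blast+

lemma boolean_algebra_assoc_distrib:
  assumes "is_boolean_algebra L" and "x \<in> elems L" and "y \<in> elems L" and "z \<in> elems L"
  shows "meet L (meet L x y) z = meet L x (meet L y z)"
    and "join L (join L x y) z = join L x (join L y z)"
    and "meet L x (join L y z) = join L (meet L x y) (meet L x z)"
    and "join L x (meet L y z) = meet L (join L x y) (join L x z)"
  using assms unfolding is_boolean_algebra_def by blast+

text \<open>By distributivity, both \<open>y\<close> and the complement given by \<open>L\<close>
  equal the meet of the two.\<close>

lemma boolean_compl_unique:
  assumes L: "is_boolean_algebra L" and x: "x \<in> elems L" and y: "y \<in> elems L"
    and "meet L x y = bottom L" and "join L x y = top_elem L"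
  shows "compl L x = y"
proof -
  note bounds = boolean_algebra_bounds[OF L] and lattice = boolean_algebra_lattice[OF L]
    and distrib = boolean_algebra_assoc_distrib(3)[OF L]
  let ?c = "compl L x"
  note c = boolean_algebra_compl[OF L x]
  note yc = lattice(1)[OF y c(1)]
  have "y = meet L y (join L x ?c)"
    using bounds(3)[OF y] c(3) by simp
  also have "\<dots> = join L (meet L y x) (meet L y ?c)"
    by (rule distrib[OF y x c(1)])
  also have "\<dots> = meet L y ?c"
    using lattice(3)[OF y x] lattice(4)[OF bounds(1) yc] bounds(4)[OF yc] assms(4) by simp
  finally have 1: "y = meet L ?c y"
    using lattice(3)[OF y c(1)] by simp
  have "?c = meet L ?c (join L x y)"
    using bounds(3)[OF c(1)] assms(5) by simp
  also have "\<dots> = join L (meet L ?c x) (meet L ?c y)"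
    by (rule distrib[OF c(1) x y])
  also have "\<dots> = join L (bottom L) y"
    using 1 lattice(3)[OF c(1) x] c(2) by simp
  also have "\<dots> = y"
    using lattice(4)[OF bounds(1) y] bounds(4)[OF y] by simp
  finally show ?thesis .
qed

lemma boolean_algebra_absorb_bounds:
  assumes L: "is_boolean_algebra L" and x: "x \<in> elems L"
  shows "meet L x (bottom L) = bottom L" "join L x (top_elem L) = top_elem L"
proof -
  note bounds = boolean_algebra_bounds[OF L] and lattice = boolean_algebra_lattice[OF L]
  have "meet L (bottom L) (join L (bottom L) x) = bottom L"
    by (rule lattice(5)[OF bounds(1) x])
  then show "meet L x (bottom L) = bottom L"
    using lattice(3,4)[OF bounds(1) x] bounds(4)[OF x] by simp
  have "join L (top_elem L) (meet L (top_elem L) x) = top_elem L"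
    by (rule lattice(6)[OF bounds(2) x])
  then show "join L x (top_elem L) = top_elem L"
    using lattice(3,4)[OF bounds(2) x] bounds(3)[OF x] by simp
qed

text \<open>By uniqueness of complements it suffices to check that the right-hand side is a
  complement. This law later identifies the complement of an intersection of factor
  congruences.\<close>

lemma boolean_compl_meet:
  assumes L: "is_boolean_algebra L" and x: "x \<in> elems L" and y: "y \<in> elems L"
  shows "compl L (meet L x y) = join L (compl L x) (compl L y)"
proof (rule boolean_compl_unique[OF L])
  note bounds = boolean_algebra_bounds[OF L] and lattice = boolean_algebra_lattice[OF L]
    and laws = boolean_algebra_assoc_distrib[OF L] and absorb = boolean_algebra_absorb_bounds[OF L]
  let ?x = "compl L x" and ?y = "compl L y"
  note cx = boolean_algebra_compl[OF L x] and cy = boolean_algebra_compl[OF L y]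
  note xy = lattice(1)[OF x y] and cxy = lattice(2)[OF cx(1) cy(1)]
  show "meet L x y \<in> elems L" "join L ?x ?y \<in> elems L"
    by (fact xy cxy)+
  have "meet L (meet L x y) ?x = meet L y (meet L x ?x)"
    using lattice(3)[OF x y] laws(1)[OF y x cx(1)] by simp
  then have 1: "meet L (meet L x y) ?x = bottom L"
    using cx(2) absorb(1)[OF y] by simp
  have 2: "meet L (meet L x y) ?y = bottom L"
    using laws(1)[OF x y cy(1)] cy(2) absorb(1)[OF x] by simp
  show "meet L (meet L x y) (join L ?x ?y) = bottom L"
    using laws(3)[OF xy cx(1) cy(1)] 1 2 bounds(4)[OF bounds(1)] by simp
  have "join L (join L ?x ?y) x = join L ?y (join L ?x x)"
    using lattice(4)[OF cx(1) cy(1)] laws(2)[OF cy(1) cx(1) x] by simp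
  then have 3: "join L (join L ?x ?y) x = top_elem L"
    using lattice(4)[OF cx(1) x] cx(3) absorb(2)[OF cy(1)] by simp
  have 4: "join L (join L ?x ?y) y = top_elem L"
    using laws(2)[OF cx(1) cy(1) y] lattice(4)[OF cy(1) y] cy(3) absorb(2)[OF cx(1)] by simp
  show "join L (meet L x y) (join L ?x ?y) = top_elem L"
    using lattice(4)[OF xy cxy] laws(4)[OF cxy x y] 3 4 bounds(3)[OF bounds(2)] by simp
qed

text \<open>Every Boolean law is an equation between elements of \<open>L\<close>; as
  \<open>\<phi>\<close> is injective and commutes with the operations, the law can be read in
  \<open>M\<close>. This spares any computation with operations defined by
  \<open>THE\<close>.\<close>

lemma boolean_algebra_transport:
  assumes M: "is_boolean_algebra M" and bij: "bij_betw \<phi> (elems L) (elems M)"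
    and bounds: "bottom L \<in> elems L" "top_elem L \<in> elems L"
      "\<phi> (bottom L) = bottom M" "\<phi> (top_elem L) = top_elem M"
    and meet: "\<And>x y. x \<in> elems L \<Longrightarrow> y \<in> elems L \<Longrightarrow>
      meet L x y \<in> elems L \<and> \<phi> (meet L x y) = meet M (\<phi> x) (\<phi> y)"
    and join: "\<And>x y. x \<in> elems L \<Longrightarrow> y \<in> elems L \<Longrightarrow>
      join L x y \<in> elems L \<and> \<phi> (join L x y) = join M (\<phi> x) (\<phi> y)"
    and compl: "\<And>x. x \<in> elems L \<Longrightarrow> compl L x \<in> elems L \<and> \<phi> (compl L x) = compl M (\<phi> x)"
  shows "is_boolean_algebra L"
proof -
  have mem: "\<phi> x \<in> elems M" if "x \<in> elems L" for x
    using bij that by (auto simp: bij_betw_def)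
  have eqI: "x = y" if "x \<in> elems L" "y \<in> elems L" "\<phi> x = \<phi> y" for x y
    using bij that by (auto simp: bij_betw_def inj_on_eq_iff)
  note closed = bounds(1,2) meet[THEN conjunct1] join[THEN conjunct1] compl[THEN conjunct1]
    and hom = bounds(3,4) meet[THEN conjunct2] join[THEN conjunct2] compl[THEN conjunct2]
    and laws = boolean_algebra_bounds[OF M] boolean_algebra_compl[OF M] boolean_algebra_lattice[OF M]
      boolean_algebra_assoc_distrib[OF M]
  show ?thesis
    unfolding is_boolean_algebra_def
  proof (intro conjI ballI)
  \<comment> \<open>Membership goals fall to the first alternative. An equation goes to the second:
    \<open>eqI\<close> moves it along \<open>\<phi>\<close>, \<open>hom\<close> pushes
    \<open>\<phi>\<close> inwards, and the result is a law of \<open>M\<close>.\<close>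
  qed ((simp only: closed; fail)
      | (rule eqI, (simp only: closed; fail), (simp only: closed; fail), simp only: hom closed,
          (rule laws; simp only: mem)))+
qed

section \<open>Congruences\<close>

lemma congruence_subset: "congruence Sg A \<theta> \<Longrightarrow> \<theta> \<subseteq> carrier A \<times> carrier A"
  by (simp add: congruence_def equiv_type)

lemma congruence_refl: "congruence Sg A \<theta> \<Longrightarrow> x \<in> carrier A \<Longrightarrow> (x, x) \<in> \<theta>"
  by (simp add: congruence_def equiv_def refl_on_def)

lemma congruence_sym: "congruence Sg A \<theta> \<Longrightarrow> (x, y) \<in> \<theta> \<Longrightarrow> (y, x) \<in> \<theta>"
  by (meson congruence_def equiv_def symD)

lemma congruence_trans: "congruence Sg A \<theta> \<Longrightarrow> (x, y) \<in> \<theta> \<Longrightarrow> (y, z) \<in> \<theta> \<Longrightarrow> (x, z) \<in> \<theta>"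
  by (meson congruence_def equiv_def transD)

lemma congruence_preimage:
  assumes "is_algebra Sg A" and "is_hom Sg A B h" and "congruence Sg B \<theta>"
  shows "congruence Sg A {(x, y). x \<in> carrier A \<and> y \<in> carrier A \<and> (h x, h y) \<in> \<theta>}"
    (is "congruence Sg A ?K")
  unfolding congruence_def
proof (intro conjI allI impI)
  have hB: "h x \<in> carrier B" if "x \<in> carrier A" for x
    using assms(2) that by (simp add: is_hom_def)
  show "equiv (carrier A) ?K"
  proof (rule equivI)
    show "refl_on (carrier A) ?K"
      using congruence_refl[OF assms(3)] hB by (auto simp: refl_on_def)
    show "sym ?K"
      using congruence_sym[OF assms(3)] by (auto simp: sym_on_def)
    show "trans ?K"
      using congruence_trans[OF assms(3)] unfolding trans_on_def by blast
  qed blast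
  fix F as bs
  assume *: "Sg F = Some (length as) \<and> list_all2 (\<lambda>a b. (a, b) \<in> ?K) as bs"
  then have sub: "set as \<subseteq> carrier A" "set bs \<subseteq> carrier A" and len: "length as = length bs"
    by (fastforce simp: list_all2_conv_all_nth in_set_conv_nth)+
  have "list_all2 (\<lambda>a b. (a, b) \<in> \<theta>) (map h as) (map h bs)"
    using * by (auto simp: list_all2_conv_all_nth)
  then have "(ops B F (map h as), ops B F (map h bs)) \<in> \<theta>"
    using assms(3) * unfolding congruence_def by auto
  moreover have "h (ops A F as) = ops B F (map h as)" "h (ops A F bs) = ops B F (map h bs)"
    using assms(2) sub * len by (auto simp: is_hom_def)
  moreover have "ops A F as \<in> carrier A" "ops A F bs \<in> carrier A"
    using assms(1) sub * len by (auto simp: is_algebra_def)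
  ultimately show "(ops A F as, ops A F bs) \<in> ?K"
    by simp
qed

lemma congruence_Id_on:
  assumes "is_algebra Sg A"
  shows "congruence Sg A (Id_on (carrier A))"
  unfolding congruence_def
proof (intro conjI allI impI)
  show "equiv (carrier A) (Id_on (carrier A))"
    by (auto intro!: equivI simp: refl_on_def sym_on_def trans_on_def)
  fix F as bs
  assume *: "Sg F = Some (length as) \<and> list_all2 (\<lambda>a b. (a, b) \<in> Id_on (carrier A)) as bs"
  then have "list_all2 (\<lambda>a b. (a, b) \<in> Id_on (carrier A)) as bs"
    by simp
  then have "as = bs \<and> set as \<subseteq> carrier A"
    by (induction rule: list_all2_induct) auto
  then show "(ops A F as, ops A F bs) \<in> Id_on (carrier A)"
    using assms * by (auto simp: is_algebra_def)
qed

lemma congruence_kernel: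
  assumes "is_algebra Sg A" and "is_algebra Sg B" and "is_hom Sg A B h"
  shows "congruence Sg A {(x, y). x \<in> carrier A \<and> y \<in> carrier A \<and> h x = h y}"
proof -
  have "{(x, y). x \<in> carrier A \<and> y \<in> carrier A \<and> h x = h y}
    = {(x, y). x \<in> carrier A \<and> y \<in> carrier A \<and> (h x, h y) \<in> Id_on (carrier B)}"
    using assms(3) by (auto simp: is_hom_def)
  then show ?thesis
    using congruence_preimage[OF assms(1,3) congruence_Id_on[OF assms(2)]] by simp
qed

text \<open>Classes are replaced by chosen representatives instead of being formed as sets. The
  quotient thus keeps the carrier type of \<open>A\<close> and stays inside the universe over which
  the properties of the variety quantify.\<close>

lemma obtain_quotient:
  fixes A :: "('f, 'a) algebra"
  assumes "is_algebra Sg A" and "congruence Sg A \<theta>"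
  obtains C :: "('f, 'a) algebra" and r
  where "is_hom Sg A C r" and "r ` carrier A = carrier C"
    and "\<And>x y. x \<in> carrier A \<Longrightarrow> y \<in> carrier A \<Longrightarrow> r x = r y \<longleftrightarrow> (x, y) \<in> \<theta>"
proof
  define r where "r x = (SOME y. (x, y) \<in> \<theta>)" for x
  let ?C = "\<lparr>carrier = r ` carrier A, ops = (\<lambda>F as. r (ops A F as))\<rparr>"
  note refl = congruence_refl[OF assms(2)] and sym = congruence_sym[OF assms(2)]
    and trans = congruence_trans[OF assms(2)]
  have r: "(x, r x) \<in> \<theta>" if "x \<in> carrier A" for x
    unfolding r_def using refl[OF that] by (rule someI)
  show r_eq: "r x = r y \<longleftrightarrow> (x, y) \<in> \<theta>" if "x \<in> carrier A" "y \<in> carrier A" for x y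
  proof
    assume "r x = r y"
    then show "(x, y) \<in> \<theta>"
      using r[OF that(1)] r[OF that(2)] sym trans by metis
  next
    assume "(x, y) \<in> \<theta>"
    \<comment> \<open>Related elements satisfy the same predicate under \<open>SOME\<close>, so the
      same representative is chosen for both.\<close>
    then have "(x, z) \<in> \<theta> \<longleftrightarrow> (y, z) \<in> \<theta>" for z
      using sym trans by blast
    then show "r x = r y"
      by (simp add: r_def)
  qed
  show "is_hom Sg A ?C r"
    unfolding is_hom_def
  proof (intro conjI allI impI ballI)
    fix F as assume *: "Sg F = Some (length as) \<and> set as \<subseteq> carrier A"
    \<comment> \<open>The operations of the quotient act on representatives, so each argument has to
      be exchanged for its representative modulo \<open>\<theta>\<close>.\<close>
    then have "list_all2 (\<lambda>a b. (a, b) \<in> \<theta>) as (map r as)"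
      using r by (simp add: list_all2_conv_all_nth subset_iff)
    then have "(ops A F as, ops A F (map r as)) \<in> \<theta>"
      using assms(2) * by (simp add: congruence_def)
    then show "r (ops A F as) = ops ?C F (map r as)"
      using r_eq congruence_subset[OF assms(2)] by auto
  qed simp
qed simp

section \<open>Joins of congruences\<close>

lemma cong_join_upper: "\<theta> \<subseteq> cong_join Sg A \<theta> \<delta>" "\<delta> \<subseteq> cong_join Sg A \<theta> \<delta>"
  by (auto simp: cong_join_def)

lemma cong_join_least:
  "congruence Sg A \<gamma> \<Longrightarrow> \<theta> \<subseteq> \<gamma> \<Longrightarrow> \<delta> \<subseteq> \<gamma> \<Longrightarrow> cong_join Sg A \<theta> \<delta> \<subseteq> \<gamma>"
  by (auto simp: cong_join_def)

text \<open>The preimage under \<open>h\<close> of the join in \<open>B\<close> is a congruence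
  above \<open>\<theta>\<close> and \<open>\<delta>\<close>, hence above their join. In the
  applications the join in \<open>B\<close> is known to be a congruence because it is a factor
  congruence.\<close>

lemma cong_join_hom:
  assumes "is_algebra Sg A" and "is_hom Sg A B h" and "congruence Sg B (cong_join Sg B \<theta>' \<delta>')"
    and "\<theta> \<subseteq> carrier A \<times> carrier A" and "\<delta> \<subseteq> carrier A \<times> carrier A"
    and "\<And>x y. (x, y) \<in> \<theta> \<Longrightarrow> (h x, h y) \<in> \<theta>'" and "\<And>x y. (x, y) \<in> \<delta> \<Longrightarrow> (h x, h y) \<in> \<delta>'"
    and "(x, y) \<in> cong_join Sg A \<theta> \<delta>"
  shows "(h x, h y) \<in> cong_join Sg B \<theta>' \<delta>'"
proof -
  let ?K = "{(x, y). x \<in> carrier A \<and> y \<in> carrier A \<and> (h x, h y) \<in> cong_join Sg B \<theta>' \<delta>'}"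
  have "\<theta> \<subseteq> ?K" "\<delta> \<subseteq> ?K"
    using assms(4-7) cong_join_upper[where Sg = Sg and A = B] by blast+
  then have "cong_join Sg A \<theta> \<delta> \<subseteq> ?K"
    using cong_join_least[OF congruence_preimage[OF assms(1-3)]] by simp
  then show ?thesis
    using assms(8) by blast
qed

section \<open>Complementary factor congruences\<close>

text \<open>Both congruences are symmetric, so composing them in the other order gives the converse
  of the universal relation.\<close>

lemma compl_factor_congs_sym:
  assumes "compl_factor_congs Sg A \<theta> \<delta>"
  shows "compl_factor_congs Sg A \<delta> \<theta>"
proof -
  have cong: "congruence Sg A \<theta>" "congruence Sg A \<delta>" and O: "\<theta> O \<delta> = carrier A \<times> carrier A"
    using assms by (auto simp: compl_factor_congs_def)
  have "\<delta>\<inverse> = \<delta>" "\<theta>\<inverse> = \<theta>"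
    using congruence_sym[OF cong(1)] congruence_sym[OF cong(2)] by auto
  then have "\<delta> O \<theta> = (\<theta> O \<delta>)\<inverse>"
    by (simp add: converse_relcomp)
  then show ?thesis
    using assms O by (auto simp: compl_factor_congs_def)
qed

lemma compl_factor_congs_mem:
  assumes "compl_factor_congs Sg A \<theta> \<delta>"
  shows "\<theta> \<in> factor_congs Sg A" "\<delta> \<in> factor_congs Sg A"
  using assms compl_factor_congs_sym[OF assms] by (auto simp: factor_congs_def)

lemma congruence_full:
  assumes "is_algebra Sg A"
  shows "congruence Sg A (carrier A \<times> carrier A)"
  unfolding congruence_def
proof (intro conjI allI impI)
  show "equiv (carrier A) (carrier A \<times> carrier A)"
    by (auto simp: equiv_def refl_on_def sym_on_def trans_on_def)
  fix F as bs
  assume *: "Sg F = Some (length as) \<and>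
    list_all2 (\<lambda>a b. (a, b) \<in> carrier A \<times> carrier A) as bs"
  then have "set as \<subseteq> carrier A" "set bs \<subseteq> carrier A" "length as = length bs"
    by (fastforce simp: list_all2_conv_all_nth in_set_conv_nth)+
  then show "(ops A F as, ops A F bs) \<in> carrier A \<times> carrier A"
    using assms * by (auto simp: is_algebra_def)
qed

text \<open>By transitivity the relational composition lies inside every congruence above both
  factors, and it is already universal.\<close>

lemma compl_factor_congs_join:
  assumes "is_algebra Sg A" and "compl_factor_congs Sg A \<theta> \<delta>"
  shows "cong_join Sg A \<theta> \<delta> = carrier A \<times> carrier A"
proof
  have cong: "congruence Sg A \<theta>" "congruence Sg A \<delta>" and O: "\<theta> O \<delta> = carrier A \<times> carrier A"
    using assms(2) by (auto simp: compl_factor_congs_def)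
  have "\<theta> O \<delta> \<subseteq> \<gamma>" if "congruence Sg A \<gamma>" "\<theta> \<subseteq> \<gamma>" "\<delta> \<subseteq> \<gamma>" for \<gamma>
    using that congruence_trans[OF that(1)] by blast
  then show "carrier A \<times> carrier A \<subseteq> cong_join Sg A \<theta> \<delta>"
    using O by (auto simp: cong_join_def)
  show "cong_join Sg A \<theta> \<delta> \<subseteq> carrier A \<times> carrier A"
    using congruence_full[OF assms(1)] cong congruence_subset by (intro cong_join_least)
qed

lemma compl_factor_congs_Id_on:
  assumes "is_algebra Sg A"
  shows "compl_factor_congs Sg A (Id_on (carrier A)) (carrier A \<times> carrier A)"
  using congruence_Id_on[OF assms] congruence_full[OF assms]
  by (auto simp: compl_factor_congs_def)

section \<open>Tuples modulo a congruence\<close>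

lemma tuple_rel_mono: "tuple_rel \<theta> as bs \<Longrightarrow> \<theta> \<subseteq> \<delta> \<Longrightarrow> tuple_rel \<delta> as bs"
  by (auto simp: tuple_rel_def list_all2_conv_all_nth)

lemma tuple_rel_Id_on: "set as \<subseteq> X \<Longrightarrow> tuple_rel (Id_on X) as as"
  by (auto simp: tuple_rel_def list_all2_conv_all_nth Id_on_iff)

lemma tuple_rel_Times:
  "tuple_rel (X \<times> Y) as bs \<longleftrightarrow> length as = length bs \<and> set as \<subseteq> X \<and> set bs \<subseteq> Y"
  by (auto simp: tuple_rel_def list_all2_conv_all_nth subset_eq all_set_conv_all_nth)

lemma tuple_rel_map:
  "tuple_rel \<theta> as bs \<Longrightarrow> (\<And>x y. (x, y) \<in> \<theta> \<Longrightarrow> (h x, h y) \<in> \<delta>) \<Longrightarrow> tuple_rel \<delta> (map h as) (map h bs)"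
  by (auto simp: tuple_rel_def list_all2_conv_all_nth)

lemma tuple_rel_sym_trans:
  assumes "congruence Sg A \<theta>" and "tuple_rel \<theta> as bs" and "tuple_rel \<theta> as cs"
  shows "tuple_rel \<theta> bs cs"
  unfolding tuple_rel_def list_all2_conv_all_nth
proof (intro conjI allI impI)
  show "length bs = length cs"
    using assms(2,3) by (simp add: tuple_rel_def list_all2_conv_all_nth)
  fix i assume "i < length bs"
  then have "(as ! i, bs ! i) \<in> \<theta>" "(as ! i, cs ! i) \<in> \<theta>"
    using assms(2,3) by (auto simp: tuple_rel_def list_all2_conv_all_nth)
  then show "(bs ! i, cs ! i) \<in> \<theta>"
    using congruence_sym[OF assms(1)] congruence_trans[OF assms(1)] by blast
qed

lemma tuple_rel_kernel:
  assumes "set as \<subseteq> carrier A" and "set bs \<subseteq> carrier A"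
  shows "tuple_rel {(x, y). x \<in> carrier A \<and> y \<in> carrier A \<and> g x = g y} as bs \<longleftrightarrow> map g as = map g bs"
  using assms unfolding subset_eq all_set_conv_all_nth tuple_rel_def list_all2_conv_all_nth
  by (auto simp: list_eq_iff_nth_eq)

text \<open>Coordinatewise, the universal composition supplies a common neighbour and the trivial
  intersection makes it unique. All the \<open>THE\<close> descriptions of elements of
  \<open>Z(A)\<close> are justified by this.\<close>

lemma compl_factor_congs_ex1_tuple:
  assumes "compl_factor_congs Sg A \<theta> \<delta>" and "length as = length bs"
    and "set as \<subseteq> carrier A" and "set bs \<subseteq> carrier A"
  shows "\<exists>!z. tuple_rel \<theta> z as \<and> tuple_rel \<delta> z bs"
proof -
  have cong: "congruence Sg A \<theta>" "congruence Sg A \<delta>"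
    and Int: "\<theta> \<inter> \<delta> = Id_on (carrier A)" and O: "\<theta> O \<delta> = carrier A \<times> carrier A"
    using assms(1) by (auto simp: compl_factor_congs_def)
  have "\<exists>c. (c, as ! i) \<in> \<theta> \<and> (c, bs ! i) \<in> \<delta>" if "i < length as" for i
  proof -
    have "as ! i \<in> carrier A" "bs ! i \<in> carrier A"
      using that assms(2-4) nth_mem by (metis subsetD)+
    then have "(as ! i, bs ! i) \<in> \<theta> O \<delta>"
      using O by simp
    then show ?thesis
      using congruence_sym[OF cong(1)] by blast
  qed
  then obtain c where c: "\<And>i. i < length as \<Longrightarrow> (c i, as ! i) \<in> \<theta> \<and> (c i, bs ! i) \<in> \<delta>"
    by metis
  show ?thesis
  proof
    show "tuple_rel \<theta> (map c [0..<length as]) as \<and> tuple_rel \<delta> (map c [0..<length as]) bs"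
      using c assms(2) by (simp add: tuple_rel_def list_all2_conv_all_nth)
    fix z assume z: "tuple_rel \<theta> z as \<and> tuple_rel \<delta> z bs"
    show "z = map c [0..<length as]"
    proof (rule nth_equalityI)
      show len: "length z = length (map c [0..<length as])"
        using z by (simp add: tuple_rel_def list_all2_conv_all_nth)
      fix i assume i: "i < length z"
      then have "(z ! i, as ! i) \<in> \<theta>" "(z ! i, bs ! i) \<in> \<delta>" "(c i, as ! i) \<in> \<theta>" "(c i, bs ! i) \<in> \<delta>"
        using z c len by (auto simp: tuple_rel_def list_all2_conv_all_nth)
      then have "(z ! i, c i) \<in> \<theta> \<inter> \<delta>"
        using cong congruence_sym congruence_trans by (metis IntI)
      then show "z ! i = map c [0..<length as] ! i"
        using Int i len by auto
    qed
  qed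
qed

section \<open>Product decompositions and factor congruences\<close>

lemma compl_factor_congs_kernels:
  assumes "is_algebra Sg A" and "is_algebra Sg A1" and "is_algebra Sg A2"
    and "is_iso Sg A (prod_alg A1 A2) \<tau>"
  shows "compl_factor_congs Sg A {(x, y). x \<in> carrier A \<and> y \<in> carrier A \<and> fst (\<tau> x) = fst (\<tau> y)}
    {(x, y). x \<in> carrier A \<and> y \<in> carrier A \<and> snd (\<tau> x) = snd (\<tau> y)}"
    (is "compl_factor_congs Sg A ?F ?G")
proof -
  have hom: "is_hom Sg A (prod_alg A1 A2) \<tau>" and inj: "inj_on \<tau> (carrier A)"
    and im: "\<tau> ` carrier A = carrier A1 \<times> carrier A2"
    using assms(4) by (auto simp: is_iso_def bij_betw_def prod_alg_def)
  \<comment> \<open>The intermediate element of the composition takes its first coordinate from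
    \<open>x\<close> and its second from \<open>y\<close>; surjectivity of \<open>\<tau>\<close>
    provides it.\<close>
  have "\<exists>z\<in>carrier A. \<tau> z = (fst (\<tau> x), snd (\<tau> y))" if "x \<in> carrier A" "y \<in> carrier A" for x y
  proof -
    have "\<tau> x \<in> carrier A1 \<times> carrier A2" "\<tau> y \<in> carrier A1 \<times> carrier A2"
      using that im by auto
    then have "(fst (\<tau> x), snd (\<tau> y)) \<in> \<tau> ` carrier A"
      unfolding im by auto
    then show ?thesis by auto
  qed
  then have "(x, y) \<in> ?F O ?G" if "x \<in> carrier A" "y \<in> carrier A" for x y
    using that by fastforce
  then have "?F O ?G = carrier A \<times> carrier A"
    by auto
  moreover have "?F \<inter> ?G = Id_on (carrier A)"
    using inj by (auto simp: inj_on_def prod_eq_iff)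
  ultimately show ?thesis
    using congruence_kernel[OF assms(1,2) is_hom_comp[OF hom is_hom_fst]]
      congruence_kernel[OF assms(1,3) is_hom_comp[OF hom is_hom_snd]]
    unfolding compl_factor_congs_def comp_apply by blast
qed

text \<open>The factors are the quotients by \<open>\<theta>\<close> and \<open>\<delta>\<close>.
  The trivial intersection makes the pairing of the two quotient maps injective, and the universal
  composition makes it surjective.\<close>

lemma obtain_factorization:
  fixes A :: "('f, 'a) algebra"
  assumes "is_algebra Sg A" and "compl_factor_congs Sg A \<theta> \<delta>"
  obtains A1 A2 :: "('f, 'a) algebra" and r s
  where "is_algebra Sg A1" and "is_algebra Sg A2" and "is_hom Sg A A1 r" and "is_hom Sg A A2 s"
    and "is_iso Sg A (prod_alg A1 A2) (\<lambda>x. (r x, s x))"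
    and "\<forall>x y. (x, y) \<in> \<theta> \<longrightarrow> r x = r y" and "\<forall>x y. (x, y) \<in> \<delta> \<longrightarrow> s x = s y"
proof -
  have cong: "congruence Sg A \<theta>" "congruence Sg A \<delta>"
    and Int: "\<theta> \<inter> \<delta> = Id_on (carrier A)" and O: "\<theta> O \<delta> = carrier A \<times> carrier A"
    using assms(2) by (auto simp: compl_factor_congs_def)
  obtain A1 :: "('f, 'a) algebra" and r where r: "is_hom Sg A A1 r" "r ` carrier A = carrier A1"
    and r_eq: "\<And>x y. x \<in> carrier A \<Longrightarrow> y \<in> carrier A \<Longrightarrow> r x = r y \<longleftrightarrow> (x, y) \<in> \<theta>"
    using obtain_quotient[OF assms(1) cong(1)] by blast
  obtain A2 :: "('f, 'a) algebra" and s where s: "is_hom Sg A A2 s" "s ` carrier A = carrier A2"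
    and s_eq: "\<And>x y. x \<in> carrier A \<Longrightarrow> y \<in> carrier A \<Longrightarrow> s x = s y \<longleftrightarrow> (x, y) \<in> \<delta>"
    using obtain_quotient[OF assms(1) cong(2)] by blast
  have "inj_on (\<lambda>x. (r x, s x)) (carrier A)"
  proof (rule inj_onI)
    fix x y assume "x \<in> carrier A" "y \<in> carrier A" "(r x, s x) = (r y, s y)"
    then have "(x, y) \<in> \<theta> \<inter> \<delta>"
      using r_eq s_eq by auto
    then show "x = y"
      using Int by auto
  qed
  moreover have "(\<lambda>x. (r x, s x)) ` carrier A = carrier A1 \<times> carrier A2"
  proof
    show "(\<lambda>x. (r x, s x)) ` carrier A \<subseteq> carrier A1 \<times> carrier A2"
      using r(2) s(2) by auto
    have "(r x, s y) \<in> (\<lambda>x. (r x, s x)) ` carrier A" if xy: "x \<in> carrier A" "y \<in> carrier A" for x y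
    proof -
      obtain z where z: "(x, z) \<in> \<theta>" "(z, y) \<in> \<delta>"
        using O xy by blast
      then have zA: "z \<in> carrier A"
        using congruence_subset[OF cong(1)] by auto
      then have "r x = r z" "s z = s y"
        using r_eq[OF xy(1) zA] s_eq[OF zA xy(2)] z by simp_all
      then have "(r x, s y) = (r z, s z)"
        by simp
      then show ?thesis
        using zA by (rule image_eqI)
    qed
    then show "carrier A1 \<times> carrier A2 \<subseteq> (\<lambda>x. (r x, s x)) ` carrier A"
      unfolding r(2)[symmetric] s(2)[symmetric] by auto
  qed
  ultimately have "is_iso Sg A (prod_alg A1 A2) (\<lambda>x. (r x, s x))"
    using is_hom_pair[OF r(1) s(1)] by (auto simp: is_iso_def bij_betw_def prod_alg_def)
  moreover have "\<forall>x y. (x, y) \<in> \<theta> \<longrightarrow> r x = r y"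
    using r_eq congruence_subset[OF cong(1)] by auto
  moreover have "\<forall>x y. (x, y) \<in> \<delta> \<longrightarrow> s x = s y"
    using s_eq congruence_subset[OF cong(2)] by auto
  ultimately show ?thesis
    by (rule that[OF is_algebra_hom_image[OF assms(1) r] is_algebra_hom_image[OF assms(1) s] r(1) s(1)])
qed

text \<open>Homomorphisms preserve closed terms, so each coordinate map takes the same values on
  \<open>e\<close> as on the matching constants of \<open>A\<close>. Two lists of terms are allowed
  so that \<open>Zs\<close>, \<open>Os\<close> serve a central element and \<open>Os\<close>,
  \<open>Zs\<close> its complement.\<close>

lemma tuple_rel_kernels_const_tuple:
  assumes A: "is_algebra Sg A" and hom: "is_hom Sg A (prod_alg A1 A2) \<tau>" and e: "set e \<subseteq> carrier A"
    and ts: "\<forall>t\<in>set ts1. wf_trm Sg t \<and> vars t = {}" "\<forall>t\<in>set ts2. wf_trm Sg t \<and> vars t = {}"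
    and len: "length ts1 = length ts2"
    and \<tau>e: "map \<tau> e = zip (const_tuple A1 ts1) (const_tuple A2 ts2)"
  shows "tuple_rel {(x, y). x \<in> carrier A \<and> y \<in> carrier A \<and> fst (\<tau> x) = fst (\<tau> y)} e (const_tuple A ts1)"
    and "tuple_rel {(x, y). x \<in> carrier A \<and> y \<in> carrier A \<and> snd (\<tau> x) = snd (\<tau> y)} e (const_tuple A ts2)"
proof -
  have "map (\<lambda>x. fst (\<tau> x)) e = const_tuple A1 ts1"
    using arg_cong[OF \<tau>e, of "map fst"] len by (simp add: comp_def)
  moreover have "map (\<lambda>x. fst (\<tau> x)) (const_tuple A ts1) = const_tuple A1 ts1"
    using map_const_tuple[OF A is_hom_comp[OF hom is_hom_fst] ts(1)] by (simp add: comp_def)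
  ultimately show "tuple_rel {(x, y). x \<in> carrier A \<and> y \<in> carrier A \<and> fst (\<tau> x) = fst (\<tau> y)} e (const_tuple A ts1)"
    using tuple_rel_kernel[OF e set_const_tuple[OF A ts(1)], of "\<lambda>x. fst (\<tau> x)"] by simp
  have "map (\<lambda>x. snd (\<tau> x)) e = const_tuple A2 ts2"
    using arg_cong[OF \<tau>e, of "map snd"] len by (simp add: comp_def)
  moreover have "map (\<lambda>x. snd (\<tau> x)) (const_tuple A ts2) = const_tuple A2 ts2"
    using map_const_tuple[OF A is_hom_comp[OF hom is_hom_snd] ts(2)] by (simp add: comp_def)
  ultimately show "tuple_rel {(x, y). x \<in> carrier A \<and> y \<in> carrier A \<and> snd (\<tau> x) = snd (\<tau> y)} e (const_tuple A ts2)"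
    using tuple_rel_kernel[OF e set_const_tuple[OF A ts(2)], of "\<lambda>x. snd (\<tau> x)"] by simp
qed

section \<open>Central elements and factor congruences\<close>

text \<open>A description of central elements without isomorphisms: under BFC,
  \<open>\<theta>\<close> and \<open>\<delta>\<close> are the congruences
  \<open>\<theta>\<^sub>0 e\<close> and \<open>\<theta>\<^sub>1 e\<close>.\<close>

definition central_pair ::
  "'f signature \<Rightarrow> ('f, nat) trm list \<Rightarrow> ('f, nat) trm list \<Rightarrow> ('f, 'a) algebra \<Rightarrow> 'a list \<Rightarrow>
     ('a \<times> 'a) set \<Rightarrow> ('a \<times> 'a) set \<Rightarrow> bool" where
  "central_pair Sg Zs Os A e \<theta> \<delta> \<longleftrightarrow> compl_factor_congs Sg A \<theta> \<delta> \<and>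
     tuple_rel \<theta> e (const_tuple A Zs) \<and> tuple_rel \<delta> e (const_tuple A Os)"

locale variety_BFC =
  fixes U :: "'u itself" and Sg :: "'f signature" and E :: "'f identity set"
    and Zs Os :: "('f, nat) trm list"
  assumes variety_01: "variety_with_01 U Sg E Zs Os"
    and BFC: "has_BFC U Sg E"
begin

abbreviation V :: "('f, 'u) algebra set" where "V \<equiv> members Sg E"

lemma variety: "is_variety Sg E"
  and length_Os: "length Os = length Zs"
  and closed_Zs: "\<forall>t\<in>set Zs. wf_trm Sg t \<and> vars t = {}"
  and closed_Os: "\<forall>t\<in>set Os. wf_trm Sg t \<and> vars t = {}"
  using variety_01 by (auto simp: variety_with_01_def)

lemma alg: "A \<in> V \<Longrightarrow> is_algebra Sg A"
  by (simp add: members_def)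

lemma set_const_tuples:
  assumes "is_algebra Sg A"
  shows "set (const_tuple A Zs) \<subseteq> carrier A" "set (const_tuple A Os) \<subseteq> carrier A"
  using set_const_tuple[OF assms] closed_Zs closed_Os by auto

lemma map_const_tuples:
  assumes "is_algebra Sg A" and "is_hom Sg A B h"
  shows "map h (const_tuple A Zs) = const_tuple B Zs" "map h (const_tuple A Os) = const_tuple B Os"
  using map_const_tuple[OF assms] closed_Zs closed_Os by auto

section \<open>Factor congruences under BFC\<close>

text \<open>The quotient by \<open>\<gamma>\<close> is again a member, and the two constant tuples
  agree there, so it has only one element.\<close>

lemma tuple_rel_01_imp_full:
  fixes A :: "('f, 'u) algebra"
  assumes "A \<in> V" and "congruence Sg A \<gamma>"
    and "tuple_rel \<gamma> (const_tuple A Zs) (const_tuple A Os)"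
  shows "\<gamma> = carrier A \<times> carrier A"
proof -
  obtain C :: "('f, 'u) algebra" and r where r: "is_hom Sg A C r" "r ` carrier A = carrier C"
    and r_eq: "\<And>x y. x \<in> carrier A \<Longrightarrow> y \<in> carrier A \<Longrightarrow> r x = r y \<longleftrightarrow> (x, y) \<in> \<gamma>"
    using obtain_quotient[OF alg[OF assms(1)] assms(2)] by blast
  have "r x = r y" if "(x, y) \<in> \<gamma>" for x y
    using that r_eq congruence_subset[OF assms(2)] by blast
  then have "map r (const_tuple A Zs) = map r (const_tuple A Os)"
    using assms(3) by (auto simp: tuple_rel_def list_all2_conv_all_nth list_eq_iff_nth_eq)
  then have "const_tuple C Zs = const_tuple C Os"
    using map_const_tuples[OF alg[OF assms(1)] r(1)] by simp
  then have "\<forall>x\<in>carrier C. \<forall>y\<in>carrier C. x = y"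
    using variety_01 members_hom_image[OF variety assms(1) r]
    unfolding variety_with_01_def by blast
  then have "(x, y) \<in> \<gamma>" if "x \<in> carrier A" "y \<in> carrier A" for x y
    using r_eq[OF that] r(2) that by blast
  then show ?thesis
    using congruence_subset[OF assms(2)] by auto
qed

text \<open>BFC only asserts that some complement operation exists. Uniqueness of complements forces
  it to send \<open>\<theta>\<close> to any complementary factor congruence \<open>\<delta>\<close>,
  since their intersection is the identity and their join is universal.\<close>

lemma obtain_factor_cong_algebra:
  fixes A :: "('f, 'u) algebra"
  assumes "A \<in> V"
  obtains L where "is_boolean_algebra L" and "elems L = factor_congs Sg A"
    and "meet L = (\<inter>)" and "join L = cong_join Sg A"
    and "bottom L = Id_on (carrier A)" and "top_elem L = carrier A \<times> carrier A"
    and "\<forall>\<theta> \<delta>. compl_factor_congs Sg A \<theta> \<delta> \<longrightarrow> compl L \<theta> = \<delta>"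
proof -
  obtain c where c: "is_boolean_algebra \<lparr>elems = factor_congs Sg A, meet = (\<inter>),
      join = cong_join Sg A, compl = c, bottom = Id_on (carrier A),
      top_elem = carrier A \<times> carrier A\<rparr>" (is "is_boolean_algebra ?L")
    using BFC assms unfolding has_BFC_def by blast
  have "c \<theta> = \<delta>" if "compl_factor_congs Sg A \<theta> \<delta>" for \<theta> \<delta>
    using boolean_compl_unique[OF c, of \<theta> \<delta>] compl_factor_congs_mem[OF that]
      compl_factor_congs_join[OF alg[OF assms] that] that
    by (simp add: compl_factor_congs_def)
  then have compl: "\<forall>\<theta> \<delta>. compl_factor_congs Sg A \<theta> \<delta> \<longrightarrow> c \<theta> = \<delta>"
    by blast
  show ?thesis
  proof (rule that[OF c])
    show "\<forall>\<theta> \<delta>. compl_factor_congs Sg A \<theta> \<delta> \<longrightarrow> compl ?L \<theta> = \<delta>"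
      unfolding bool_struct.select_convs by (rule compl)
  qed (simp_all only: bool_struct.select_convs)
qed

text \<open>BFC makes the intersection a factor congruence with some complement, and De Morgan's law
  in the Boolean lattice says which one. The definition of the meet in \<open>Z(A)\<close> rests on
  this pair.\<close>

lemma compl_factor_congs_meet_join:
  fixes A :: "('f, 'u) algebra"
  assumes "A \<in> V" and 1: "compl_factor_congs Sg A \<theta>1 \<delta>1" and 2: "compl_factor_congs Sg A \<theta>2 \<delta>2"
  shows "compl_factor_congs Sg A (\<theta>1 \<inter> \<theta>2) (cong_join Sg A \<delta>1 \<delta>2)"
proof -
  obtain L where L: "is_boolean_algebra L" "elems L = factor_congs Sg A"
    "meet L = (\<inter>)" "join L = cong_join Sg A"
    and compl: "\<forall>\<theta> \<delta>. compl_factor_congs Sg A \<theta> \<delta> \<longrightarrow> compl L \<theta> = \<delta>"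
    by (rule obtain_factor_cong_algebra[OF assms(1)], rule that)
  note mem = compl_factor_congs_mem(1)[OF 1] compl_factor_congs_mem(1)[OF 2]
  have "\<theta>1 \<inter> \<theta>2 \<in> factor_congs Sg A"
    using boolean_algebra_lattice(1)[OF L(1), of \<theta>1 \<theta>2] L(2,3) mem by simp
  then obtain \<delta> where \<delta>: "compl_factor_congs Sg A (\<theta>1 \<inter> \<theta>2) \<delta>"
    unfolding factor_congs_def by blast
  have "compl L \<theta>1 = \<delta>1" "compl L \<theta>2 = \<delta>2" "compl L (\<theta>1 \<inter> \<theta>2) = \<delta>"
    using compl 1 2 \<delta> by blast+
  then have "\<delta> = cong_join Sg A \<delta>1 \<delta>2"
    using boolean_compl_meet[OF L(1), of \<theta>1 \<theta>2] L(2-4) mem by simp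
  then show ?thesis
    using \<delta> by simp
qed

text \<open>The join of \<open>\<theta>2\<close> and \<open>\<delta>1\<close> identifies \<open>0\<close> with \<open>1\<close> (both with \<open>e\<close>), hence is full, and then
  distributivity gives \<open>\<theta>1 \<subseteq> \<theta>2\<close>.\<close>

lemma central_pair_subset:
  fixes A :: "('f, 'u) algebra"
  assumes "A \<in> V" and 1: "central_pair Sg Zs Os A e \<theta>1 \<delta>1" and 2: "central_pair Sg Zs Os A e \<theta>2 \<delta>2"
  shows "\<theta>1 \<subseteq> \<theta>2"
proof -
  obtain L where L: "is_boolean_algebra L" "elems L = factor_congs Sg A"
    "meet L = (\<inter>)" "join L = cong_join Sg A"
    "bottom L = Id_on (carrier A)" "top_elem L = carrier A \<times> carrier A"
    by (rule obtain_factor_cong_algebra[OF assms(1)], rule that)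
  have c: "compl_factor_congs Sg A \<theta>1 \<delta>1" "compl_factor_congs Sg A \<theta>2 \<delta>2"
    using 1 2 by (auto simp: central_pair_def)
  note mem = compl_factor_congs_mem[OF c(1)] compl_factor_congs_mem[OF c(2)]
  have "cong_join Sg A \<theta>2 \<delta>1 \<in> factor_congs Sg A"
    using boolean_algebra_lattice(2)[OF L(1), of \<theta>2 \<delta>1] L(2,4) mem by simp
  then have cong: "congruence Sg A (cong_join Sg A \<theta>2 \<delta>1)"
    by (auto simp: factor_congs_def compl_factor_congs_def)
  have "tuple_rel \<theta>2 e (const_tuple A Zs)" "tuple_rel \<delta>1 e (const_tuple A Os)"
    using 1 2 by (simp_all add: central_pair_def)
  from tuple_rel_mono[OF this(1) cong_join_upper(1)] tuple_rel_mono[OF this(2) cong_join_upper(2)]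
  have "tuple_rel (cong_join Sg A \<theta>2 \<delta>1) e (const_tuple A Zs)"
    "tuple_rel (cong_join Sg A \<theta>2 \<delta>1) e (const_tuple A Os)"
    by blast+
  then have "cong_join Sg A \<theta>2 \<delta>1 = carrier A \<times> carrier A"
    by (rule tuple_rel_01_imp_full[OF assms(1) cong tuple_rel_sym_trans[OF cong]])
  moreover have "\<theta>1 \<subseteq> carrier A \<times> carrier A"
    using c congruence_subset by (auto simp: compl_factor_congs_def)
  ultimately have "\<theta>1 = \<theta>1 \<inter> cong_join Sg A \<theta>2 \<delta>1"
    by auto
  also have "\<dots> = cong_join Sg A (\<theta>1 \<inter> \<theta>2) (\<theta>1 \<inter> \<delta>1)"
    using boolean_algebra_assoc_distrib(3)[OF L(1), of \<theta>1 \<theta>2 \<delta>1] L(2-4) mem by simp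
  also have "\<theta>1 \<inter> \<delta>1 = Id_on (carrier A)"
    using c by (simp add: compl_factor_congs_def)
  also have "cong_join Sg A (\<theta>1 \<inter> \<theta>2) (Id_on (carrier A)) = \<theta>1 \<inter> \<theta>2"
    using boolean_algebra_bounds(4)[OF L(1), of "\<theta>1 \<inter> \<theta>2"]
      boolean_algebra_lattice(1)[OF L(1), of \<theta>1 \<theta>2] L(2-5) mem by simp
  finally show ?thesis by blast
qed

text \<open>The inclusion, used in both directions, gives equality of the first congruences; their
  complements in the Boolean lattice then agree too.\<close>

lemma central_pair_unique:
  fixes A :: "('f, 'u) algebra"
  assumes "A \<in> V" and 1: "central_pair Sg Zs Os A e \<theta>1 \<delta>1" and 2: "central_pair Sg Zs Os A e \<theta>2 \<delta>2"
  shows "\<theta>1 = \<theta>2" "\<delta>1 = \<delta>2"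
proof -
  show \<theta>: "\<theta>1 = \<theta>2"
    using central_pair_subset[OF assms(1)] 1 2 by blast
  obtain L :: "('u \<times> 'u) set bool_struct"
    where compl: "\<forall>\<theta> \<delta>. compl_factor_congs Sg A \<theta> \<delta> \<longrightarrow> compl L \<theta> = \<delta>"
    by (rule obtain_factor_cong_algebra[OF assms(1)], rule that)
  have "compl L \<theta>1 = \<delta>1" "compl L \<theta>2 = \<delta>2"
    using compl 1 2 unfolding central_pair_def by blast+
  then show "\<delta>1 = \<delta>2"
    using \<theta> by simp
qed

text \<open>Uniqueness of the pair turns the \<open>THE\<close> in \<open>theta_pair\<close> into a
  rule: exhibiting any central pair for \<open>e\<close> computes both of its congruences.\<close>

lemma theta_eqI:
  fixes A :: "('f, 'u) algebra"
  assumes "A \<in> V" and "central_pair Sg Zs Os A e \<theta> \<delta>"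
  shows "theta0 Sg Zs Os A e = \<theta>" "theta1 Sg Zs Os A e = \<delta>"
proof -
  have "theta_pair Sg Zs Os A e = (\<theta>, \<delta>)"
    unfolding theta_pair_def central_pair_def[symmetric]
  proof (rule the_equality)
    show "p = (\<theta>, \<delta>)" if "central_pair Sg Zs Os A e (fst p) (snd p)" for p
      using central_pair_unique[OF assms(1) that assms(2)] by (simp add: prod_eq_iff)
  qed (use assms(2) in simp)
  then show "theta0 Sg Zs Os A e = \<theta>" "theta1 Sg Zs Os A e = \<delta>"
    by (simp_all add: theta0_def theta1_def)
qed

section \<open>Central elements described by pairs of congruences\<close>

text \<open>From an isomorphism one takes the kernels of its two coordinate maps; from the
  congruences one takes the two quotients. Complements correspond to swapping the pair.\<close>

lemma compl_central_iff:
  fixes A :: "('f, 'u) algebra"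
  assumes A: "is_algebra Sg A"
  shows "compl_central Sg Zs Os A e f \<longleftrightarrow>
    (\<exists>\<theta> \<delta>. central_pair Sg Zs Os A e \<theta> \<delta> \<and> central_pair Sg Zs Os A f \<delta> \<theta>)"
proof
  assume "compl_central Sg Zs Os A e f"
  then obtain A1 A2 :: "('f, 'u) algebra" and \<tau> where e: "set e \<subseteq> carrier A" "set f \<subseteq> carrier A"
    and A12: "is_algebra Sg A1" "is_algebra Sg A2" and \<tau>: "is_iso Sg A (prod_alg A1 A2) \<tau>"
    and \<tau>e: "map \<tau> e = zip (const_tuple A1 Zs) (const_tuple A2 Os)"
    and \<tau>f: "map \<tau> f = zip (const_tuple A1 Os) (const_tuple A2 Zs)"
    unfolding compl_central_def by blast
  let ?F = "{(x, y). x \<in> carrier A \<and> y \<in> carrier A \<and> fst (\<tau> x) = fst (\<tau> y)}"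
    and ?G = "{(x, y). x \<in> carrier A \<and> y \<in> carrier A \<and> snd (\<tau> x) = snd (\<tau> y)}"
  have hom: "is_hom Sg A (prod_alg A1 A2) \<tau>"
    using \<tau> by (simp add: is_iso_def)
  note c = compl_factor_congs_kernels[OF A A12 \<tau>]
  have "central_pair Sg Zs Os A e ?F ?G"
    using c tuple_rel_kernels_const_tuple[OF A hom e(1) closed_Zs closed_Os length_Os[symmetric] \<tau>e]
    by (simp only: central_pair_def simp_thms)
  moreover have "central_pair Sg Zs Os A f ?G ?F"
    using compl_factor_congs_sym[OF c]
      tuple_rel_kernels_const_tuple[OF A hom e(2) closed_Os closed_Zs length_Os \<tau>f]
    by (simp only: central_pair_def simp_thms)
  ultimately show "\<exists>\<theta> \<delta>. central_pair Sg Zs Os A e \<theta> \<delta> \<and> central_pair Sg Zs Os A f \<delta> \<theta>"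
    by blast
next
  assume "\<exists>\<theta> \<delta>. central_pair Sg Zs Os A e \<theta> \<delta> \<and> central_pair Sg Zs Os A f \<delta> \<theta>"
  then obtain \<theta> \<delta> where c: "compl_factor_congs Sg A \<theta> \<delta>"
    and e: "tuple_rel \<theta> e (const_tuple A Zs)" "tuple_rel \<delta> e (const_tuple A Os)"
    and f: "tuple_rel \<delta> f (const_tuple A Zs)" "tuple_rel \<theta> f (const_tuple A Os)"
    by (auto simp: central_pair_def)
  obtain A1 A2 :: "('f, 'u) algebra" and r s
    where A12: "is_algebra Sg A1" "is_algebra Sg A2" and r: "is_hom Sg A A1 r" "is_hom Sg A A2 s"
      and iso: "is_iso Sg A (prod_alg A1 A2) (\<lambda>x. (r x, s x))"
      and r_eq: "\<forall>x y. (x, y) \<in> \<theta> \<longrightarrow> r x = r y" "\<forall>x y. (x, y) \<in> \<delta> \<longrightarrow> s x = s y"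
    using obtain_factorization[OF A c] by blast
  \<comment> \<open>A tuple congruent to \<open>as\<close> modulo \<open>\<theta>\<close> and to
    \<open>bs\<close> modulo \<open>\<delta>\<close> has coordinates read off from \<open>as\<close>
    and \<open>bs\<close>.\<close>
  have tuple: "map (\<lambda>x. (r x, s x)) g = zip (map r as) (map s bs)"
    if "tuple_rel \<theta> g as" "tuple_rel \<delta> g bs" for g as bs
    using that r_eq by (auto simp: tuple_rel_def list_all2_conv_all_nth list_eq_iff_nth_eq)
  have "congruence Sg A \<theta>"
    using c by (simp add: compl_factor_congs_def)
  then have sub: "\<theta> \<subseteq> carrier A \<times> carrier A"
    by (rule congruence_subset)
  have "set e \<subseteq> carrier A" "set f \<subseteq> carrier A"
    using tuple_rel_mono[OF e(1) sub] tuple_rel_mono[OF f(2) sub] by (simp_all add: tuple_rel_Times)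
  moreover have "map (\<lambda>x. (r x, s x)) e = zip (const_tuple A1 Zs) (const_tuple A2 Os)"
    "map (\<lambda>x. (r x, s x)) f = zip (const_tuple A1 Os) (const_tuple A2 Zs)"
    using tuple[OF e] tuple[OF f(2,1)] map_const_tuples[OF A r(1)] map_const_tuples[OF A r(2)]
    by simp_all
  ultimately show "compl_central Sg Zs Os A e f"
    unfolding compl_central_def using A12 iso by blast
qed

lemma central_elems_iff:
  fixes A :: "('f, 'u) algebra"
  assumes A: "is_algebra Sg A"
  shows "e \<in> central_elems Sg Zs Os A \<longleftrightarrow> (\<exists>\<theta> \<delta>. central_pair Sg Zs Os A e \<theta> \<delta>)"
proof
  assume "e \<in> central_elems Sg Zs Os A"
  then obtain A1 A2 :: "('f, 'u) algebra" and \<tau> where e: "set e \<subseteq> carrier A"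
    and A12: "is_algebra Sg A1" "is_algebra Sg A2" and \<tau>: "is_iso Sg A (prod_alg A1 A2) \<tau>"
    and \<tau>e: "map \<tau> e = zip (const_tuple A1 Zs) (const_tuple A2 Os)"
    unfolding central_elems_def by blast
  have hom: "is_hom Sg A (prod_alg A1 A2) \<tau>"
    using \<tau> by (simp add: is_iso_def)
  show "\<exists>\<theta> \<delta>. central_pair Sg Zs Os A e \<theta> \<delta>"
    unfolding central_pair_def
    by (intro exI) (rule conjI[OF compl_factor_congs_kernels[OF A A12 \<tau>] conjI[OF
        tuple_rel_kernels_const_tuple[OF A hom e closed_Zs closed_Os length_Os[symmetric] \<tau>e]]])
next
  assume "\<exists>\<theta> \<delta>. central_pair Sg Zs Os A e \<theta> \<delta>"
  then obtain \<theta> \<delta> where e: "central_pair Sg Zs Os A e \<theta> \<delta>"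
    by blast
  then have c: "compl_factor_congs Sg A \<delta> \<theta>"
    using compl_factor_congs_sym by (auto simp: central_pair_def)
  \<comment> \<open>Solving for the swapped pair yields a complement \<open>f\<close> of
    \<open>e\<close>; the decomposition witnessing complementarity also witnesses that
    \<open>e\<close> is central.\<close>
  have "\<exists>f. central_pair Sg Zs Os A f \<delta> \<theta>"
    using compl_factor_congs_ex1_tuple[OF c _ set_const_tuples[OF A]] length_Os c
    by (auto simp: central_pair_def)
  then have "\<exists>f. compl_central Sg Zs Os A e f"
    using e compl_central_iff[OF A] by blast
  then show "e \<in> central_elems Sg Zs Os A"
    unfolding compl_central_def central_elems_def by blast
qed

lemma central_pair_tuple_unique:
  fixes A :: "('f, 'u) algebra"
  assumes "is_algebra Sg A" and "central_pair Sg Zs Os A e \<theta> \<delta>" and "central_pair Sg Zs Os A f \<theta> \<delta>"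
  shows "e = f"
proof -
  have "\<exists>!z. tuple_rel \<theta> z (const_tuple A Zs) \<and> tuple_rel \<delta> z (const_tuple A Os)"
    using assms(2) compl_factor_congs_ex1_tuple[OF _ _ set_const_tuples[OF assms(1)], of Sg \<theta> \<delta>]
      length_Os
    by (simp add: central_pair_def)
  then show ?thesis
    using assms(2,3) unfolding central_pair_def by blast
qed

text \<open>Every pair of complementary factor congruences comes from a central element. Together
  with \<open>central_pair_tuple_unique\<close> this makes central elements and such pairs
  correspond one to one.\<close>

lemma central_pair_the:
  fixes A :: "('f, 'u) algebra"
  assumes "is_algebra Sg A" and "compl_factor_congs Sg A \<theta> \<delta>"
  shows "central_pair Sg Zs Os A
    (THE z. tuple_rel \<theta> z (const_tuple A Zs) \<and> tuple_rel \<delta> z (const_tuple A Os)) \<theta> \<delta>"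
proof -
  have "\<exists>!z. tuple_rel \<theta> z (const_tuple A Zs) \<and> tuple_rel \<delta> z (const_tuple A Os)"
    using compl_factor_congs_ex1_tuple[OF assms(2) _ set_const_tuples[OF assms(1)]] length_Os by simp
  from theI'[OF this] show ?thesis
    using assms(2) by (simp add: central_pair_def)
qed

lemma central_pair_theta:
  fixes A :: "('f, 'u) algebra"
  assumes "A \<in> V" and "e \<in> central_elems Sg Zs Os A"
  shows "central_pair Sg Zs Os A e (theta0 Sg Zs Os A e) (theta1 Sg Zs Os A e)"
proof -
  obtain \<theta> \<delta> where "central_pair Sg Zs Os A e \<theta> \<delta>"
    using assms central_elems_iff[OF alg[OF assms(1)]] by blast
  then show ?thesis
    using theta_eqI[OF assms(1)] by simp
qed

lemma compl_factor_congs_theta: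
  fixes A :: "('f, 'u) algebra"
  assumes "A \<in> V" and "e \<in> central_elems Sg Zs Os A"
  shows "compl_factor_congs Sg A (theta0 Sg Zs Os A e) (theta1 Sg Zs Os A e)"
  using central_pair_theta[OF assms] by (simp add: central_pair_def)

section \<open>The Boolean algebra of central elements\<close>

lemma elems_central_algebra [simp]:
  "elems (central_algebra Sg Zs Os A) = central_elems Sg Zs Os A"
  by (simp add: central_algebra_def)

context
  fixes A :: "('f, 'u) algebra"
  assumes A: "A \<in> V"
begin

lemma central_pair_meet:
  assumes "e \<in> central_elems Sg Zs Os A" and "f \<in> central_elems Sg Zs Os A"
  shows "central_pair Sg Zs Os A (meet (central_algebra Sg Zs Os A) e f)
    (theta0 Sg Zs Os A e \<inter> theta0 Sg Zs Os A f)
    (cong_join Sg A (theta1 Sg Zs Os A e) (theta1 Sg Zs Os A f))"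
  using central_pair_the[OF alg[OF A] compl_factor_congs_meet_join[OF A
      compl_factor_congs_theta[OF A assms(1)] compl_factor_congs_theta[OF A assms(2)]]]
  by (simp add: central_algebra_def)

text \<open>Dual to the meet: the rule for intersections is applied to the two swapped pairs, and
  the outcome is swapped back.\<close>

lemma central_pair_join:
  assumes "e \<in> central_elems Sg Zs Os A" and "f \<in> central_elems Sg Zs Os A"
  shows "central_pair Sg Zs Os A (join (central_algebra Sg Zs Os A) e f)
    (cong_join Sg A (theta0 Sg Zs Os A e) (theta0 Sg Zs Os A f))
    (theta1 Sg Zs Os A e \<inter> theta1 Sg Zs Os A f)"
  using central_pair_the[OF alg[OF A] compl_factor_congs_sym[OF compl_factor_congs_meet_join[OF A
      compl_factor_congs_sym[OF compl_factor_congs_theta[OF A assms(1)]]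
      compl_factor_congs_sym[OF compl_factor_congs_theta[OF A assms(2)]]]]]
  by (simp add: central_algebra_def)

lemma central_pair_compl:
  assumes "e \<in> central_elems Sg Zs Os A"
  shows "central_pair Sg Zs Os A (compl (central_algebra Sg Zs Os A) e)
    (theta1 Sg Zs Os A e) (theta0 Sg Zs Os A e)"
  using central_pair_the[OF alg[OF A]
      compl_factor_congs_sym[OF compl_factor_congs_theta[OF A assms]]]
  by (simp add: central_algebra_def conj_commute)

lemma central_pair_bottom:
  "central_pair Sg Zs Os A (const_tuple A Zs) (Id_on (carrier A)) (carrier A \<times> carrier A)"
  and central_pair_top:
  "central_pair Sg Zs Os A (const_tuple A Os) (carrier A \<times> carrier A) (Id_on (carrier A))"
  using set_const_tuples[OF alg[OF A]] compl_factor_congs_Id_on[OF alg[OF A]]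
    compl_factor_congs_sym[OF compl_factor_congs_Id_on[OF alg[OF A]]] length_Os
  by (simp_all add: central_pair_def tuple_rel_Id_on tuple_rel_Times)

text \<open>The laws are inherited from the factor congruences along the bijection
  \<open>\<theta>\<^sub>0\<close>, whose compatibility with each operation is read off from the
  central pair of the result.\<close>

lemma is_boolean_algebra_central: "is_boolean_algebra (central_algebra Sg Zs Os A)"
proof -
  obtain L where L: "is_boolean_algebra L" "elems L = factor_congs Sg A"
    "meet L = (\<inter>)" "join L = cong_join Sg A"
    "bottom L = Id_on (carrier A)" "top_elem L = carrier A \<times> carrier A"
    and compl: "\<forall>\<theta> \<delta>. compl_factor_congs Sg A \<theta> \<delta> \<longrightarrow> compl L \<theta> = \<delta>"
    by (rule obtain_factor_cong_algebra[OF A], rule that)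
  let ?Z = "central_algebra Sg Zs Os A" and ?\<theta> = "theta0 Sg Zs Os A" and ?\<delta> = "theta1 Sg Zs Os A"
  note theta = theta_eqI[OF A] and pair = central_pair_theta[OF A]
  have mem: "e \<in> elems ?Z" if "central_pair Sg Zs Os A e \<theta> \<delta>" for e \<theta> \<delta>
    using that central_elems_iff[OF alg[OF A]] by auto
  have compl_theta: "compl L (?\<theta> e) = ?\<delta> e" if "e \<in> elems ?Z" for e
    using compl compl_factor_congs_theta[OF A, of e] that unfolding elems_central_algebra by blast
  show ?thesis
  proof (rule boolean_algebra_transport[OF L(1)])
    show "bij_betw ?\<theta> (elems ?Z) (elems L)"
    proof (rule bij_betw_imageI)
      show "inj_on ?\<theta> (elems ?Z)"
      proof (rule inj_onI)
        fix e f assume "e \<in> elems ?Z" "f \<in> elems ?Z" and "?\<theta> e = ?\<theta> f"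
        \<comment> \<open>The second congruence is the complement of the first, so equality of the
          first ones gives the whole pair, which determines the tuple.\<close>
        moreover from this have "?\<delta> e = ?\<delta> f"
          using compl_theta by metis
        ultimately show "e = f"
          using pair[of e] pair[of f] central_pair_tuple_unique[OF alg[OF A]] by simp
      qed
      show "?\<theta> ` elems ?Z = elems L"
      proof
        show "?\<theta> ` elems ?Z \<subseteq> elems L"
          using compl_factor_congs_mem(1)[OF compl_factor_congs_theta[OF A]] L(2) by auto
        show "elems L \<subseteq> ?\<theta> ` elems ?Z"
        proof
          fix \<theta> assume "\<theta> \<in> elems L"
          then obtain \<delta> where "compl_factor_congs Sg A \<theta> \<delta>"
            using L(2) by (auto simp: factor_congs_def)
          note z = central_pair_the[OF alg[OF A] this]
          show "\<theta> \<in> ?\<theta> ` elems ?Z"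
            using theta(1)[OF z, symmetric] mem[OF z] by (rule image_eqI)
        qed
      qed
    qed
    show "bottom ?Z \<in> elems ?Z" "top_elem ?Z \<in> elems ?Z"
      using mem[OF central_pair_bottom] mem[OF central_pair_top] by (simp_all add: central_algebra_def)
    show "?\<theta> (bottom ?Z) = bottom L" "?\<theta> (top_elem ?Z) = top_elem L"
      using theta(1)[OF central_pair_bottom] theta(1)[OF central_pair_top] L
      by (simp_all add: central_algebra_def)
    show "meet ?Z e f \<in> elems ?Z \<and> ?\<theta> (meet ?Z e f) = meet L (?\<theta> e) (?\<theta> f)"
      if "e \<in> elems ?Z" "f \<in> elems ?Z" for e f
      using mem[OF central_pair_meet] theta(1)[OF central_pair_meet] that L(3) by simp
    show "join ?Z e f \<in> elems ?Z \<and> ?\<theta> (join ?Z e f) = join L (?\<theta> e) (?\<theta> f)"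
      if "e \<in> elems ?Z" "f \<in> elems ?Z" for e f
      using mem[OF central_pair_join] theta(1)[OF central_pair_join] that L(4) by simp
    show "compl ?Z e \<in> elems ?Z \<and> ?\<theta> (compl ?Z e) = compl L (?\<theta> e)" if "e \<in> elems ?Z" for e
      using mem[OF central_pair_compl] theta(1)[OF central_pair_compl] that compl_theta by simp
  qed
qed

end

end

section \<open>Homomorphisms between members\<close>

text \<open>An infinite set is equipotent with its square. The injection serves to copy products of
  members into the universe.\<close>

lemma obtain_inj_pair:
  assumes "infinite (UNIV :: 'u set)"
  obtains \<iota> :: "'u \<times> 'u \<Rightarrow> 'u" where "inj \<iota>"
proof -
  have "(card_of (UNIV \<times> UNIV :: ('u \<times> 'u) set), card_of (UNIV :: 'u set)) \<in> ordIso"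
    using assms by (rule card_of_Times_same_infinite)
  then show ?thesis
    using that card_of_ordIso[of "UNIV :: ('u \<times> 'u) set" "UNIV :: 'u set"]
    by (auto simp: bij_betw_def)
qed

text \<open>After decomposing \<open>A\<close> along \<open>e\<close> and \<open>B\<close> along
  \<open>map h e\<close>, \<open>A \<times> B\<close> regroups as
  \<open>(A1 \<times> B1) \<times> (A2 \<times> B2)\<close>, and the embedding of \<open>A\<close>
  sends \<open>e\<close> to the tuple \<open>(0, 1)\<close> of this product. The formula
  \<open>l\<close> can therefore be evaluated on both sides of the embedding.\<close>

lemma (in variety_BFC) theta1_hom:
  fixes A B :: "('f, 'u) algebra"
  assumes inf: "infinite (UNIV :: 'u set)"
    and RexDFC: "has_RexDFC TYPE('u) Sg E Zs Os"
    and A: "A \<in> V" and B: "B \<in> V" and h: "is_hom Sg A B h"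
    and e: "e \<in> central_elems Sg Zs Os A" and he: "map h e \<in> central_elems Sg Zs Os B"
    and xy: "(x, y) \<in> theta1 Sg Zs Os A e"
  shows "(h x, h y) \<in> theta1 Sg Zs Os B (map h e)"
proof -
  obtain l where l: "wf_fm Sg l" "existential l" "fv l \<subseteq> {..<length Zs + 2}"
    and def: "\<And>(A :: ('f, 'u) algebra) (B :: ('f, 'u) algebra) a b c d.
      A \<in> V \<Longrightarrow> B \<in> V \<Longrightarrow> a \<in> carrier A \<Longrightarrow> b \<in> carrier A \<Longrightarrow> c \<in> carrier B \<Longrightarrow> d \<in> carrier B \<Longrightarrow>
      holds (prod_alg A B) l (zip (const_tuple A Zs) (const_tuple B Os) @ [(a, c), (b, d)]) \<longleftrightarrow> c = d"
    using RexDFC unfolding has_RexDFC_def by blast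
  \<comment> \<open>RexDFC only speaks about members over \<open>'u\<close>, so \<open>A1 \<times> B1\<close> and \<open>A2 \<times> B2\<close> are copied into \<open>'u\<close>.\<close>
  obtain \<iota> :: "'u \<times> 'u \<Rightarrow> 'u" where \<iota>: "inj \<iota>"
    using obtain_inj_pair[OF inf] by blast
  note algs = alg[OF A] alg[OF B]
  obtain A1 A2 :: "('f, 'u) algebra" and \<tau> where e_sub: "set e \<subseteq> carrier A"
    and A12: "is_algebra Sg A1" "is_algebra Sg A2" and \<tau>: "is_iso Sg A (prod_alg A1 A2) \<tau>"
    and \<tau>e: "map \<tau> e = zip (const_tuple A1 Zs) (const_tuple A2 Os)"
    using e unfolding central_elems_def by blast
  obtain B1 B2 :: "('f, 'u) algebra" and \<sigma> where he_sub: "set (map h e) \<subseteq> carrier B"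
    and B12: "is_algebra Sg B1" "is_algebra Sg B2" and \<sigma>: "is_iso Sg B (prod_alg B1 B2) \<sigma>"
    and \<sigma>he: "map \<sigma> (map h e) = zip (const_tuple B1 Zs) (const_tuple B2 Os)"
    using he unfolding central_elems_def by blast
  have \<tau>_hom: "is_hom Sg A (prod_alg A1 A2) \<tau>" and \<tau>_inj: "inj_on \<tau> (carrier A)"
    and \<tau>_im: "\<tau> ` carrier A = carrier A1 \<times> carrier A2"
    using \<tau> by (auto simp: is_iso_def bij_betw_def prod_alg_def)
  have \<sigma>_hom: "is_hom Sg B (prod_alg B1 B2) \<sigma>" and \<sigma>_im: "\<sigma> ` carrier B = carrier B1 \<times> carrier B2"
    using \<sigma> by (auto simp: is_iso_def bij_betw_def prod_alg_def)
  \<comment> \<open>Any decomposition sending \<open>e\<close> to \<open>(0, 1)\<close> may be used,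
    as the pair of congruences of \<open>e\<close> is unique; \<open>theta1\<close> is the kernel of
    the second coordinate.\<close>
  have theta_A: "theta1 Sg Zs Os A e
      = {(x, y). x \<in> carrier A \<and> y \<in> carrier A \<and> snd (\<tau> x) = snd (\<tau> y)}"
    by (rule theta_eqI(2)[OF A, unfolded central_pair_def,
          OF conjI[OF compl_factor_congs_kernels[OF algs(1) A12 \<tau>] conjI[OF
          tuple_rel_kernels_const_tuple[OF algs(1) \<tau>_hom e_sub closed_Zs closed_Os length_Os[symmetric] \<tau>e]]]])
  have theta_B: "theta1 Sg Zs Os B (map h e)
      = {(x, y). x \<in> carrier B \<and> y \<in> carrier B \<and> snd (\<sigma> x) = snd (\<sigma> y)}"
    by (rule theta_eqI(2)[OF B, unfolded central_pair_def,
          OF conjI[OF compl_factor_congs_kernels[OF algs(2) B12 \<sigma>] conjI[OF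
          tuple_rel_kernels_const_tuple[OF algs(2) \<sigma>_hom he_sub closed_Zs closed_Os length_Os[symmetric] \<sigma>he]]]])
  have factors: "A1 \<in> V" "A2 \<in> V" "B1 \<in> V" "B2 \<in> V"
  proof -
    \<comment> \<open>A projection of a product is onto only because the other factor is
      nonempty.\<close>
    have ne: "carrier A1 \<noteq> {}" "carrier A2 \<noteq> {}" "carrier B1 \<noteq> {}" "carrier B2 \<noteq> {}"
      using A12 B12 by (auto simp: is_algebra_def)
    have "(fst \<circ> \<tau>) ` carrier A = carrier A1" "(snd \<circ> \<tau>) ` carrier A = carrier A2"
      "(fst \<circ> \<sigma>) ` carrier B = carrier B1" "(snd \<circ> \<sigma>) ` carrier B = carrier B2"
      unfolding image_comp[symmetric] \<tau>_im \<sigma>_im using ne by simp_all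
    then show "A1 \<in> V" "A2 \<in> V" "B1 \<in> V" "B2 \<in> V"
      using members_hom_image[OF variety A] members_hom_image[OF variety B]
        is_hom_comp[OF \<tau>_hom is_hom_fst] is_hom_comp[OF \<tau>_hom is_hom_snd]
        is_hom_comp[OF \<sigma>_hom is_hom_fst] is_hom_comp[OF \<sigma>_hom is_hom_snd] by metis+
  qed
  note prods = members_prod[OF variety factors(1,3)] members_prod[OF variety factors(2,4)]
  have prod_algs: "is_algebra Sg (prod_alg A1 B1)" "is_algebra Sg (prod_alg A2 B2)"
    using is_algebra_prod A12 B12 by auto
  obtain C1 where C1: "is_hom Sg (prod_alg A1 B1) C1 \<iota>" "\<iota> ` carrier (prod_alg A1 B1) = carrier C1"
    using obtain_transported_algebra[OF prod_algs(1) \<iota>] by blast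
  obtain C2 where C2: "is_hom Sg (prod_alg A2 B2) C2 \<iota>" "\<iota> ` carrier (prod_alg A2 B2) = carrier C2"
    using obtain_transported_algebra[OF prod_algs(2) \<iota>] by blast
  note CV = members_hom_image[OF variety prods(1) C1] members_hom_image[OF variety prods(2) C2]
  \<comment> \<open>\<open>u\<close> and \<open>v\<close> are the two coordinates of
    \<open>(x, h x)\<close> after regrouping: \<open>u\<close> collects the first factors of
    \<open>A\<close> and \<open>B\<close>, \<open>v\<close> the second ones.\<close>
  define u where "u = (\<lambda>x. \<iota> (fst (\<tau> x), fst (\<sigma> (h x))))"
  define v where "v = (\<lambda>x. \<iota> (snd (\<tau> x), snd (\<sigma> (h x))))"
  have u: "is_hom Sg A C1 u"
    using is_hom_comp[OF is_hom_pair[OF is_hom_comp[OF \<tau>_hom is_hom_fst]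
          is_hom_comp[OF is_hom_comp[OF h \<sigma>_hom] is_hom_fst]] C1(1)]
    by (simp add: comp_def u_def)
  have v: "is_hom Sg A C2 v"
    using is_hom_comp[OF is_hom_pair[OF is_hom_comp[OF \<tau>_hom is_hom_snd]
          is_hom_comp[OF is_hom_comp[OF h \<sigma>_hom] is_hom_snd]] C2(1)]
    by (simp add: comp_def v_def)
  define g where "g = (\<lambda>x. (u x, v x))"
  let ?\<tau>' = "inv_into (carrier A) \<tau>"
  \<comment> \<open>Injectivity comes from the components in \<open>A1\<close> and \<open>A2\<close>
    alone, which recover \<open>\<tau> x\<close>; nothing is asked of \<open>h\<close>.\<close>
  have g_inj: "inj_on g (carrier A)"
  proof (rule inj_onI)
    fix a b assume "a \<in> carrier A" "b \<in> carrier A" "g a = g b"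
    moreover from this have "\<tau> a = \<tau> b"
      by (simp add: g_def u_def v_def inj_eq[OF \<iota>] prod_eq_iff)
    ultimately show "a = b"
      using \<tau>_inj by (simp add: inj_on_eq_iff)
  qed
  \<comment> \<open>The formula is available on a product, so the embedding has to start at
    \<open>A1 \<times> A2\<close> rather than at \<open>A\<close>; hence the inverse of
    \<open>\<tau>\<close>.\<close>
  have j: "is_hom Sg (prod_alg A1 A2) (prod_alg C1 C2) (g \<circ> ?\<tau>')"
    using is_hom_comp[OF is_hom_inv_into[OF algs(1) \<tau>] is_hom_pair[OF u v]] by (simp add: g_def)
  have "bij_betw ?\<tau>' (carrier A1 \<times> carrier A2) (carrier A)"
    using bij_betw_inv_into[of \<tau> "carrier A"] \<tau>_inj \<tau>_im by (simp add: bij_betw_def)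
  then have j_inj: "inj_on (g \<circ> ?\<tau>') (carrier (prod_alg A1 A2))"
    using g_inj by (auto simp: prod_alg_def bij_betw_def intro: comp_inj_on)
  have xyA: "x \<in> carrier A" "y \<in> carrier A" and snd_eq: "snd (\<tau> x) = snd (\<tau> y)"
    using xy theta_A by auto
  then have \<tau>xy: "\<tau> x \<in> carrier A1 \<times> carrier A2" "\<tau> y \<in> carrier A1 \<times> carrier A2"
    using \<tau>_im by auto
  let ?vs = "map \<tau> e @ [\<tau> x, \<tau> y]"
  have "holds (prod_alg A1 A2) l ?vs \<longleftrightarrow> snd (\<tau> x) = snd (\<tau> y)"
    using def[OF factors(1,2), of "fst (\<tau> x)" "fst (\<tau> y)" "snd (\<tau> x)" "snd (\<tau> y)"] \<tau>xy
    by (simp add: \<tau>e mem_Times_iff)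
  then have "holds (prod_alg A1 A2) l ?vs"
    using snd_eq by (rule iffD2)
  moreover have "set ?vs \<subseteq> carrier (prod_alg A1 A2)"
    using e_sub xyA \<tau>_im by (auto simp: prod_alg_def)
  moreover have "length e = length Zs"
    using arg_cong[OF \<tau>e, of length] length_Os by simp
  moreover from this have "fv l \<subseteq> {..<length ?vs}"
    using l(3) by simp
  ultimately have C: "holds (prod_alg C1 C2) l (map (g \<circ> ?\<tau>') ?vs)"
    by (intro holds_existential_embedding[OF is_algebra_prod[OF A12] j j_inj l(2,1)])
  have vs: "map (g \<circ> ?\<tau>') ?vs = map g e @ [g x, g y]"
    using e_sub xyA \<tau>_inj by (auto simp: inv_into_f_f)
  have ge: "map g e = zip (const_tuple C1 Zs) (const_tuple C2 Os)"
  proof -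
    have "map u e = map \<iota> (zip (map (\<lambda>x. fst (\<tau> x)) e) (map (\<lambda>x. fst (\<sigma> (h x))) e))"
      "map v e = map \<iota> (zip (map (\<lambda>x. snd (\<tau> x)) e) (map (\<lambda>x. snd (\<sigma> (h x))) e))"
      by (simp_all add: u_def v_def zip_map_map zip_same_conv_map)
    moreover have "map (\<lambda>x. fst (\<tau> x)) e = const_tuple A1 Zs" "map (\<lambda>x. snd (\<tau> x)) e = const_tuple A2 Os"
      using arg_cong[OF \<tau>e, of "map fst"] arg_cong[OF \<tau>e, of "map snd"] length_Os
      by (simp_all add: comp_def)
    moreover have "map (\<lambda>x. fst (\<sigma> (h x))) e = const_tuple B1 Zs"
      "map (\<lambda>x. snd (\<sigma> (h x))) e = const_tuple B2 Os"
      using arg_cong[OF \<sigma>he, of "map fst"] arg_cong[OF \<sigma>he, of "map snd"] length_Os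
      by (simp_all add: comp_def)
    ultimately have "map u e = map \<iota> (zip (const_tuple A1 Zs) (const_tuple B1 Zs))"
      "map v e = map \<iota> (zip (const_tuple A2 Os) (const_tuple B2 Os))"
      by simp_all
    moreover have "zip (const_tuple A1 Zs) (const_tuple B1 Zs) = const_tuple (prod_alg A1 B1) Zs"
      "zip (const_tuple A2 Os) (const_tuple B2 Os) = const_tuple (prod_alg A2 B2) Os"
      using map_const_tuples(1)[OF prod_algs(1) is_hom_fst] map_const_tuples(1)[OF prod_algs(1) is_hom_snd]
        map_const_tuples(2)[OF prod_algs(2) is_hom_fst] map_const_tuples(2)[OF prod_algs(2) is_hom_snd]
        zip_map_fst_snd[of "const_tuple (prod_alg A1 B1) Zs"]
        zip_map_fst_snd[of "const_tuple (prod_alg A2 B2) Os"]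
      by simp_all
    ultimately have "map u e = const_tuple C1 Zs" "map v e = const_tuple C2 Os"
      using map_const_tuples(1)[OF prod_algs(1) C1(1)] map_const_tuples(2)[OF prod_algs(2) C2(1)] by simp_all
    moreover have "map g e = zip (map u e) (map v e)"
      by (simp add: g_def zip_map_map zip_same_conv_map)
    ultimately show ?thesis
      by simp
  qed
  have "u x \<in> carrier C1" "u y \<in> carrier C1" "v x \<in> carrier C2" "v y \<in> carrier C2"
    using u v xyA by (auto simp: is_hom_def)
  moreover have "holds (prod_alg C1 C2) l
      (zip (const_tuple C1 Zs) (const_tuple C2 Os) @ [(u x, v x), (u y, v y)])"
    using C unfolding vs ge unfolding g_def .
  \<comment> \<open>In \<open>C1 \<times> C2\<close> the formula again means equality of second
    coordinates, and \<open>v\<close> contains the second coordinate of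
    \<open>\<sigma> (h x)\<close>.\<close>
  ultimately have "v x = v y"
    using def[OF CV] by blast
  then have "snd (\<sigma> (h x)) = snd (\<sigma> (h y))"
    using \<iota> by (auto simp: v_def inj_eq)
  then show ?thesis
    using theta_B xyA h by (auto simp: is_hom_def)
qed

text \<open>The image \<open>map h z\<close> satisfies the two conditions that single out
  \<open>z'\<close>. Each operation of the Boolean algebra is reduced to inclusions between
  congruences by this.\<close>

lemma (in variety_BFC) central_pair_hom_eq:
  fixes A B :: "('f, 'u) algebra"
  assumes "is_algebra Sg A" and "is_algebra Sg B" and "is_hom Sg A B h"
    and "central_pair Sg Zs Os A z \<theta> \<delta>" and "central_pair Sg Zs Os B z' \<theta>' \<delta>'"
    and "\<And>x y. (x, y) \<in> \<theta> \<Longrightarrow> (h x, h y) \<in> \<theta>'" and "\<And>x y. (x, y) \<in> \<delta> \<Longrightarrow> (h x, h y) \<in> \<delta>'"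
  shows "map h z = z'"
proof -
  have "tuple_rel \<theta>' (map h z) (const_tuple B Zs)" "tuple_rel \<delta>' (map h z) (const_tuple B Os)"
    using assms(4) tuple_rel_map[of \<theta> z "const_tuple A Zs" h \<theta>', OF _ assms(6)]
      tuple_rel_map[of \<delta> z "const_tuple A Os" h \<delta>', OF _ assms(7)] map_const_tuples[OF assms(1,3)]
    by (auto simp: central_pair_def)
  then show ?thesis
    using central_pair_tuple_unique[OF assms(2) _ assms(5)] assms(5)
    by (simp add: central_pair_def)
qed

section \<open>The induced Boolean homomorphism\<close>

theorem lemma21:
  fixes Sg :: "'f signature" and E :: "'f identity set"
    and Zs Os :: "('f, nat) trm list"
    and A B :: "('f, 'u) algebra" and h :: "'u \<Rightarrow> 'u"
  assumes "infinite (UNIV :: 'u set)"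
    and "has_RexDFC TYPE('u) Sg E Zs Os"
    and "stable_by_complements TYPE('u) Sg E Zs Os"
    and "A \<in> members Sg E" and "B \<in> members Sg E"
    and "is_hom Sg A B h"
  shows "is_boolean_hom (central_algebra Sg Zs Os A) (central_algebra Sg Zs Os B) (map h)"
proof -
  interpret variety_BFC "TYPE('u)" Sg E Zs Os
    using assms(2) by unfold_locales (auto simp: has_RexDFC_def)
  note A = assms(4) and B = assms(5) and h = assms(6)
  note hom_eq = central_pair_hom_eq[OF alg[OF A] alg[OF B] h]
  let ?ZA = "central_elems Sg Zs Os A" and ?ZB = "central_elems Sg Zs Os B"
  let ?A = "central_algebra Sg Zs Os A" and ?B = "central_algebra Sg Zs Os B"
  have preserves: "preserves_compl_central Sg Zs Os A B h"
    using assms(3) A B h by (simp add: stable_by_complements_def)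
  then have central: "map h e \<in> ?ZB" if "e \<in> ?ZA" for e
    using that by (simp add: preserves_compl_central_def)
  have t1: "(h x, h y) \<in> theta1 Sg Zs Os B (map h e)"
    if "e \<in> ?ZA" "(x, y) \<in> theta1 Sg Zs Os A e" for e x y
    using theta1_hom[OF assms(1,2) A B h that(1) central[OF that(1)] that(2)] .
  have t0: "(h x, h y) \<in> theta0 Sg Zs Os B (map h e)"
    if e: "e \<in> ?ZA" and xy: "(x, y) \<in> theta0 Sg Zs Os A e" for e x y
  proof -
    \<comment> \<open>The complement \<open>?f\<close> satisfies
      \<open>\<theta>\<^sub>1 ?f = \<theta>\<^sub>0 e\<close>. Preservation of complementary pairs
      gives the same relation between \<open>map h ?f\<close> and \<open>map h e\<close>, so the
      claim for \<open>theta1\<close> applies to \<open>?f\<close>.\<close>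
    let ?f = "compl ?A e"
    note f = central_pair_compl[OF A e]
    then have fZ: "?f \<in> ?ZA"
      using central_elems_iff[OF alg[OF A]] by blast
    have "compl_central Sg Zs Os A e ?f"
      using central_pair_theta[OF A e] f compl_central_iff[OF alg[OF A]] by blast
    then have "compl_central Sg Zs Os B (map h e) (map h ?f)"
      using preserves by (simp add: preserves_compl_central_def)
    then obtain \<theta> \<delta> where "central_pair Sg Zs Os B (map h e) \<theta> \<delta>"
      "central_pair Sg Zs Os B (map h ?f) \<delta> \<theta>"
      using compl_central_iff[OF alg[OF B]] by blast
    then have "theta0 Sg Zs Os B (map h e) = theta1 Sg Zs Os B (map h ?f)"
      using theta_eqI[OF B] by metis
    moreover have "(x, y) \<in> theta1 Sg Zs Os A ?f"
      using theta_eqI(2)[OF A f] xy by simp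
    ultimately show ?thesis
      using t1[OF fZ] by simp
  qed
  have sub: "theta0 Sg Zs Os A e \<subseteq> carrier A \<times> carrier A" "theta1 Sg Zs Os A e \<subseteq> carrier A \<times> carrier A"
    if "e \<in> ?ZA" for e
    using central_pair_theta[OF A that] congruence_subset
    by (auto simp: central_pair_def compl_factor_congs_def)
  have "map h (meet ?A e f) = meet ?B (map h e) (map h f)" if e: "e \<in> ?ZA" and f: "f \<in> ?ZA" for e f
  proof (rule hom_eq[OF central_pair_meet[OF A e f]])
    show "central_pair Sg Zs Os B (meet ?B (map h e) (map h f))
      (theta0 Sg Zs Os B (map h e) \<inter> theta0 Sg Zs Os B (map h f))
      (cong_join Sg B (theta1 Sg Zs Os B (map h e)) (theta1 Sg Zs Os B (map h f)))"
      by (rule central_pair_meet[OF B central[OF e] central[OF f]])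
    \<comment> \<open>No separate proof that this join is a congruence is called for: it is one half
      of the central pair of the meet in \<open>Z(B)\<close>.\<close>
    then have cong: "congruence Sg B (cong_join Sg B (theta1 Sg Zs Os B (map h e)) (theta1 Sg Zs Os B (map h f)))"
      by (simp add: central_pair_def compl_factor_congs_def)
    show "(h x, h y) \<in> theta0 Sg Zs Os B (map h e) \<inter> theta0 Sg Zs Os B (map h f)"
      if "(x, y) \<in> theta0 Sg Zs Os A e \<inter> theta0 Sg Zs Os A f" for x y
      using that t0 e f by blast
    show "(h x, h y) \<in> cong_join Sg B (theta1 Sg Zs Os B (map h e)) (theta1 Sg Zs Os B (map h f))"
      if "(x, y) \<in> cong_join Sg A (theta1 Sg Zs Os A e) (theta1 Sg Zs Os A f)" for x y
      using cong_join_hom[OF alg[OF A] h cong sub(2)[OF e] sub(2)[OF f] t1[OF e] t1[OF f] that] .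
  qed
  moreover have "map h (join ?A e f) = join ?B (map h e) (map h f)" if e: "e \<in> ?ZA" and f: "f \<in> ?ZA" for e f
  proof (rule hom_eq[OF central_pair_join[OF A e f]])
    show "central_pair Sg Zs Os B (join ?B (map h e) (map h f))
      (cong_join Sg B (theta0 Sg Zs Os B (map h e)) (theta0 Sg Zs Os B (map h f)))
      (theta1 Sg Zs Os B (map h e) \<inter> theta1 Sg Zs Os B (map h f))"
      by (rule central_pair_join[OF B central[OF e] central[OF f]])
    then have cong: "congruence Sg B (cong_join Sg B (theta0 Sg Zs Os B (map h e)) (theta0 Sg Zs Os B (map h f)))"
      by (simp add: central_pair_def compl_factor_congs_def)
    show "(h x, h y) \<in> theta1 Sg Zs Os B (map h e) \<inter> theta1 Sg Zs Os B (map h f)"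
      if "(x, y) \<in> theta1 Sg Zs Os A e \<inter> theta1 Sg Zs Os A f" for x y
      using that t1 e f by blast
    show "(h x, h y) \<in> cong_join Sg B (theta0 Sg Zs Os B (map h e)) (theta0 Sg Zs Os B (map h f))"
      if "(x, y) \<in> cong_join Sg A (theta0 Sg Zs Os A e) (theta0 Sg Zs Os A f)" for x y
      using cong_join_hom[OF alg[OF A] h cong sub(1)[OF e] sub(1)[OF f] t0[OF e] t0[OF f] that] .
  qed
  moreover have "map h (compl ?A e) = compl ?B (map h e)" if e: "e \<in> ?ZA" for e
    \<comment> \<open>Complementation swaps the two congruences, so \<open>t1\<close> handles the
      first component and \<open>t0\<close> the second.\<close>
    by (rule hom_eq[OF central_pair_compl[OF A e] central_pair_compl[OF B central[OF e]] t1[OF e] t0[OF e]])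
  moreover have "map h (bottom ?A) = bottom ?B" "map h (top_elem ?A) = top_elem ?B"
    using map_const_tuples[OF alg[OF A] h] by (auto simp: central_algebra_def)
  ultimately show ?thesis
    using is_boolean_algebra_central[OF A] is_boolean_algebra_central[OF B] central
    by (simp add: is_boolean_hom_def)
qed

end
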